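(* Let $R$ be a commutative Noetherian ring, $I$ an ideal of $R$, and $M$ a finitely generated $R$-module such that $M\neq H^0_I(M)$. Then $r(I^{n+1},M)=I\cdot r(I^n,M)+(H^0_I(M):M)$ for all $n\gg 0$.
   Context: $H^0_I(M)=\{m\in M : I^nm=0 \text{ for some } n\geq 1\}$ is the $I$-torsion submodule of $M$. For submodules $A,B$ of $M$, $(A:B)=\{x\in R : xB\subseteq A\}$. For $n\geq 1$, $r(I^n,M)=\bigcup_{k\geq 1}(I^{n+k}M:I^kM)$ (an ascending union of ideals of $R$). *)

theory Defs
  imports "HOL-Algebra.Algebra"
begin

definition gen_submodule ::
    "('a, 'r) ring_scheme \<Rightarrow> ('a, 'b, 'm) module_scheme \<Rightarrow> 'b set \<Rightarrow> 'b set"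
  where "gen_submodule R M S = \<Inter>{N. submodule N R M \<and> S \<subseteq> N}"

definition fin_gen_module ::
    "('a, 'r) ring_scheme \<Rightarrow> ('a, 'b, 'm) module_scheme \<Rightarrow> bool"
  where "fin_gen_module R M \<longleftrightarrow>
    module R M \<and> (\<exists>A\<subseteq>carrier M. finite A \<and> carrier M = gen_submodule R M A)"

text \<open>The power is taken in the multiplicative monoid of ideals, so the zeroth power of
  \<open>I\<close> is \<open>carrier R\<close> and each further power is a product of ideals (finite sums of products
  of elements).\<close>

abbreviation ideal_pow :: "('a, 'r) ring_scheme \<Rightarrow> 'a set \<Rightarrow> nat \<Rightarrow> 'a set"
  where "ideal_pow R I n \<equiv> I [^]\<^bsub>ideals_set R\<^esub> n"

text \<open>The product \<open>J N\<close> of an ideal and a submodule; as for products of ideals, the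
  products of elements only generate it.\<close>

definition ideal_smult ::
    "('a, 'r) ring_scheme \<Rightarrow> ('a, 'b, 'm) module_scheme \<Rightarrow> 'a set \<Rightarrow> 'b set \<Rightarrow> 'b set"
  where "ideal_smult R M J N = gen_submodule R M {a \<odot>\<^bsub>M\<^esub> x | a x. a \<in> J \<and> x \<in> N}"

definition torsion_submodule ::
    "('a, 'r) ring_scheme \<Rightarrow> ('a, 'b, 'm) module_scheme \<Rightarrow> 'a set \<Rightarrow> 'b set"
  where "torsion_submodule R M I =
    {m \<in> carrier M. \<exists>n\<ge>1. \<forall>a\<in>ideal_pow R I n. a \<odot>\<^bsub>M\<^esub> m = \<zero>\<^bsub>M\<^esub>}"

definition module_colon ::
    "('a, 'r) ring_scheme \<Rightarrow> ('a, 'b, 'm) module_scheme \<Rightarrow> 'b set \<Rightarrow> 'b set \<Rightarrow> 'a set"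
  where "module_colon R M A B = {x \<in> carrier R. \<forall>b\<in>B. x \<odot>\<^bsub>M\<^esub> b \<in> A}"

text \<open>\<open>rr_ideal R M I n\<close> is \<open>r(I\<^sup>n, M)\<close>. It takes \<open>I\<close> and \<open>n\<close> separately because the
  definition refers to powers of \<open>I\<close> itself, not only to the ideal \<open>I\<^sup>n\<close>.\<close>

definition rr_ideal ::
    "('a, 'r) ring_scheme \<Rightarrow> ('a, 'b, 'm) module_scheme \<Rightarrow> 'a set \<Rightarrow> nat \<Rightarrow> 'a set"
  where "rr_ideal R M I n =
    (\<Union>k\<in>{1..}. module_colon R M (ideal_smult R M (ideal_pow R I (n + k)) (carrier M))
                             (ideal_smult R M (ideal_pow R I k) (carrier M)))"

end

theory Submission
  imports Defs
begin

text \<open>Write \<open>r\<^sub>n = r(I\<^sup>n, M)\<close> and \<open>T = H\<^sup>0\<^sub>I(M)\<close>. The inclusion of \<open>I r\<^sub>n + (T : M)\<close> in \<open>r\<^sub>n\<^sub>+\<^sub>1\<close> is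
elementary and holds for all \<open>n\<close>; for the second summand, a fixed power of \<open>I\<close> kills \<open>x M\<close> for
\<open>x \<in> (T : M)\<close>, since \<open>M\<close> is finitely generated. The other inclusion is a finiteness statement, and
its source is that the Rees module \<open>\<Oplus>\<^sub>n I\<^sup>n M\<close> is a Noetherian graded module
(\<open>graded_chain_stabilizes\<close>). This is used twice.

It shows that in the associated graded module the elements killed by a power of the irrelevant ideal
have bounded degree (\<open>eventually_no_irrelevant_torsion\<close>): there is \<open>K\<close> such that, for \<open>n \<ge> K\<close>, an
element \<open>m\<close> of \<open>I\<^sup>n M\<close> with \<open>I\<^sup>k m \<subseteq> I\<^sup>n\<^sup>+\<^sup>k\<^sup>+\<^sup>1 M\<close> for some \<open>k\<close> already lies in
\<open>I\<^sup>n\<^sup>+\<^sup>1 M\<close>. If \<open>x\<close> multiplies \<open>I\<^sup>k M\<close> into \<open>I\<^sup>n\<^sup>+\<^sup>k M\<close> for some \<open>k\<close>, this moves \<open>x I\<^sup>K M\<close> step by step from \<open>I\<^sup>K M\<close> into \<open>I\<^sup>n\<^sup>+\<^sup>K M\<close>. Hence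
\<open>r\<^sub>n = (I\<^sup>n\<^sup>+\<^sup>K M : I\<^sup>K M)\<close> with one \<open>K\<close> for all \<open>n\<close> (\<open>rr_ideal_eq_colon\<close>).

Now let \<open>l\<^sub>1, \<dots>, l\<^sub>q\<close> generate \<open>I\<^sup>K M\<close> and map \<open>x \<in> R\<close> to \<open>(x l\<^sub>1, \<dots>, x l\<^sub>q)\<close>. The image of \<open>r\<^sub>n\<close> lies
in \<open>I\<^sup>n M\<^sup>q\<close>, so the images form a graded submodule of the Rees module of \<open>M\<^sup>q\<close>. It is generated in
bounded degrees, as in the lemma of Artin and Rees, so for large \<open>n\<close> the image of \<open>r\<^sub>n\<^sub>+\<^sub>1\<close> equals
that of \<open>I r\<^sub>n\<close> (\<open>colon_recursion_modulo_annihilator\<close>). The kernel of the map consists of the \<open>x\<close>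
with \<open>x I\<^sup>K M = 0\<close>; for these \<open>I\<^sup>K\<close> kills \<open>x M\<close>, so they belong to \<open>(T : M)\<close>.\<close>

section \<open>Stabilization of chains\<close>

lemma (in noetherian_ring) ideal_chain_stabilizes:
  assumes "mono W" and "\<And>k::nat. ideal (W k) R"
  shows "\<exists>p. \<forall>k\<ge>p. W k = W p"
proof -
  have "\<Union>(range W) \<in> range W"
  proof (rule ideal_chain_is_trivial)
    show "subset.chain {I. ideal I R} (range W)"
      unfolding subset_chain_def
    proof (intro conjI ballI)
      show "range W \<subseteq> {I. ideal I R}" using assms(2) by blast
      fix A B assume "A \<in> range W" "B \<in> range W"
      then obtain i j where "A = W i" "B = W j" by blast
      thus "A \<subseteq> B \<or> B \<subseteq> A" using monoD[OF assms(1)] linear[of i j] by blast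
    qed
  qed simp
  then obtain p where p: "\<Union>(range W) = W p" by blast
  have "W k = W p" if "p \<le> k" for k
    using p monoD[OF assms(1) that] by blast
  thus ?thesis by blast
qed

text \<open>If \<open>L d k\<close> increases in both arguments, the diagonal \<open>L k k\<close> is constant from some \<open>q\<close> on, which
settles all rows \<open>d \<ge> q\<close> at once; only finitely many rows remain, and each stabilizes separately.
So the rows stabilize uniformly.\<close>
lemma double_chain_stabilizes:
  fixes L :: "nat \<Rightarrow> nat \<Rightarrow> 'c::order"
  assumes mono_fst: "\<And>k. mono (\<lambda>d. L d k)" and mono_snd: "\<And>d. mono (L d)"
    and stab: "\<And>W. mono W \<Longrightarrow> (\<And>k::nat. \<exists>d j. W k = L d j) \<Longrightarrow> \<exists>p. \<forall>k\<ge>p. W k = W p"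
  shows "\<exists>p. \<forall>k\<ge>p. \<forall>d. L d k = L d p"
proof -
  have mono: "L d k \<le> L d' k'" if "d \<le> d'" "k \<le> k'" for d d' k k'
    using monoD[OF mono_fst that(1)] monoD[OF mono_snd that(2)] order_trans by blast
  have "\<exists>p. \<forall>k\<ge>p. L k k = L p p"
    by (rule stab) (auto intro!: monoI mono)
  then obtain q where q: "\<And>k. k \<ge> q \<Longrightarrow> L k k = L q q" by blast
  have "\<forall>d. \<exists>p. \<forall>k\<ge>p. L d k = L d p"
    using stab[OF mono_snd] by blast
  then obtain f where f: "\<And>d k. k \<ge> f d \<Longrightarrow> L d k = L d (f d)" by metis
  define p where "p = Max (insert q (f ` {..<q}))"
  have p: "q \<le> p" "\<And>d. d < q \<Longrightarrow> f d \<le> p"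
    by (auto simp: p_def)
  have "L d k = L d p" if "p \<le> k" for d k
  proof (cases "d < q")
    case True
    thus ?thesis using f[of d k] f[of d p] p(2)[of d] that by simp
  next
    case False
    have const: "L d j = L q q" if "q \<le> j" for j
    proof (rule antisym)
      have "L d j \<le> L (max d j) (max d j)" by (rule mono) auto
      also have "\<dots> = L q q" using q[of "max d j"] that by simp
      finally show "L d j \<le> L q q" .
      show "L q q \<le> L d j" using mono False that by simp
    qed
    \<comment> \<open>The rows \<open>d \<ge> q\<close> all have the value \<open>L q q\<close> from \<open>q\<close> on.\<close>
    show ?thesis using const p(1) that by simp
  qed
  thus ?thesis by blast
qed

context module
begin

section \<open>Submodules\<close>

lemma submodule_if_closed:
  assumes "H \<subseteq> carrier M" "\<zero>\<^bsub>M\<^esub> \<in> H"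
    and "\<And>x y. x \<in> H \<Longrightarrow> y \<in> H \<Longrightarrow> x \<oplus>\<^bsub>M\<^esub> y \<in> H"
    and "\<And>a x. a \<in> carrier R \<Longrightarrow> x \<in> H \<Longrightarrow> a \<odot>\<^bsub>M\<^esub> x \<in> H"
  shows "submodule H R M"
proof (rule submoduleI)
  fix x assume x: "x \<in> H"
  hence "\<ominus>\<^bsub>M\<^esub> x = (\<ominus> \<one>) \<odot>\<^bsub>M\<^esub> x"
    using assms(1) smult_l_minus[of \<one> x] by auto
  thus "\<ominus>\<^bsub>M\<^esub> x \<in> H" using assms(4) x by simp
qed (use assms in auto)

lemma ideal_if_closed:
  assumes "J \<subseteq> carrier R" "\<zero> \<in> J"
    and "\<And>x y. x \<in> J \<Longrightarrow> y \<in> J \<Longrightarrow> x \<oplus> y \<in> J"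
    and "\<And>a x. a \<in> carrier R \<Longrightarrow> x \<in> J \<Longrightarrow> a \<otimes> x \<in> J"
  shows "ideal J R"
proof (rule idealI)
  show "ring R" by (rule R.ring_axioms)
  show "subgroup J (add_monoid R)"
  proof (rule R.add.subgroupI)
    show "J \<noteq> {}" using assms(2) by blast
    show "\<ominus> x \<in> J" if x: "x \<in> J" for x
    proof -
      have "\<ominus> x = (\<ominus> \<one>) \<otimes> x" using assms(1) x by (simp add: R.l_minus subset_iff)
      thus ?thesis using assms(4)[of "\<ominus> \<one>" x] x by simp
    qed
  qed (simp_all add: assms(1,3))
  show "a \<otimes> x \<in> J" if "a \<in> J" "x \<in> carrier R" for a x
    using assms(1) assms(4)[OF that(2,1)] that R.m_comm[of x a] by auto
  show "x \<otimes> a \<in> J" if "a \<in> J" "x \<in> carrier R" for a x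
    using assms(4)[OF that(2,1)] .
qed

lemma submodule_carrier: "submodule N R M \<Longrightarrow> x \<in> N \<Longrightarrow> x \<in> carrier M"
  using submoduleE(1) by blast

lemma submodule_zero: "submodule N R M \<Longrightarrow> \<zero>\<^bsub>M\<^esub> \<in> N"
  by (metis M.r_neg submoduleE(2,3,5) all_not_in_conv submodule_carrier)

lemma submodule_diff:
  "submodule N R M \<Longrightarrow> x \<in> N \<Longrightarrow> y \<in> N \<Longrightarrow> x \<ominus>\<^bsub>M\<^esub> y \<in> N"
  by (simp add: a_minus_def submoduleE(3,5))

lemma zero_submodule: "submodule {\<zero>\<^bsub>M\<^esub>} R M"
  by (rule submodule_if_closed) auto

lemma submodule_Int:
  assumes "submodule N R M" "submodule N' R M"
  shows "submodule (N \<inter> N') R M"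
  by (rule submodule_if_closed)
    (use assms in \<open>auto simp: submodule_zero submoduleE(4,5) submodule_carrier\<close>)

lemma gen_submodule_submodule:
  assumes "S \<subseteq> carrier M"
  shows "submodule (gen_submodule R M S) R M"
proof (rule submodule_if_closed)
  show "gen_submodule R M S \<subseteq> carrier M"
    using assms carrier_is_submodule by (auto simp: gen_submodule_def)
qed (auto simp: gen_submodule_def submodule_zero submoduleE(4,5))

lemma gen_submodule_incl: "S \<subseteq> gen_submodule R M S"
  by (auto simp: gen_submodule_def)

lemma gen_submodule_least:
  "submodule N R M \<Longrightarrow> S \<subseteq> N \<Longrightarrow> gen_submodule R M S \<subseteq> N"
  by (auto simp: gen_submodule_def)

text \<open>The colons \<open>(N :\<^sub>R S)\<close> and, in the next lemma, \<open>(N :\<^sub>M S)\<close> replace computations with finite sums: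
a condition on all elements of an ideal or a submodule is checked on generators because the
elements that satisfy it form a colon.\<close>
lemma colon_ideal:
  assumes "submodule N R M" "S \<subseteq> carrier M"
  shows "ideal {a \<in> carrier R. \<forall>x\<in>S. a \<odot>\<^bsub>M\<^esub> x \<in> N} R"
  by (rule ideal_if_closed)
    (use assms in \<open>auto simp: submodule_zero smult_l_distr smult_assoc1 submoduleE(4,5) subset_iff\<close>)

lemma colon_submodule:
  assumes "submodule N R M" "S \<subseteq> carrier R"
  shows "submodule {x \<in> carrier M. \<forall>a\<in>S. a \<odot>\<^bsub>M\<^esub> x \<in> N} R M"
proof (rule submodule_if_closed, goal_cases)
  case (4 b x)
  have "a \<odot>\<^bsub>M\<^esub> (b \<odot>\<^bsub>M\<^esub> x) = b \<odot>\<^bsub>M\<^esub> (a \<odot>\<^bsub>M\<^esub> x)" if "a \<in> S" for a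
    using assms 4 that by (metis (no_types, lifting) R.m_comm mem_Collect_eq smult_assoc1 subsetD)
  thus ?case using 4 assms by (auto simp: submoduleE(4))
qed (use assms in \<open>auto simp: submodule_zero smult_r_distr submoduleE(5) subset_iff\<close>)

lemma smult_diff:
  assumes "a \<in> carrier R" "x \<in> carrier M" "y \<in> carrier M"
  shows "a \<odot>\<^bsub>M\<^esub> (x \<ominus>\<^bsub>M\<^esub> y) = a \<odot>\<^bsub>M\<^esub> x \<ominus>\<^bsub>M\<^esub> a \<odot>\<^bsub>M\<^esub> y"
  using assms by (simp add: a_minus_def smult_r_distr smult_r_minus)

lemma diff_smult:
  assumes "a \<in> carrier R" "b \<in> carrier R" "x \<in> carrier M"
  shows "(a \<ominus> b) \<odot>\<^bsub>M\<^esub> x = a \<odot>\<^bsub>M\<^esub> x \<ominus>\<^bsub>M\<^esub> b \<odot>\<^bsub>M\<^esub> x"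
  using assms by (simp add: a_minus_def smult_l_distr smult_l_minus)

lemma add_diff_cancel_left:
  assumes "u \<in> carrier M" "v \<in> carrier M" "w \<in> carrier M"
  shows "(u \<oplus>\<^bsub>M\<^esub> v) \<ominus>\<^bsub>M\<^esub> (u \<oplus>\<^bsub>M\<^esub> w) = v \<ominus>\<^bsub>M\<^esub> w"
  using assms M.a_lcomm[of v "\<ominus>\<^bsub>M\<^esub> u" "\<ominus>\<^bsub>M\<^esub> w"]
  by (simp add: a_minus_def M.minus_add M.a_assoc M.r_neg2)

lemma add_diff_cancel:
  assumes "x \<in> carrier M" "y \<in> carrier M"
  shows "y \<oplus>\<^bsub>M\<^esub> (x \<ominus>\<^bsub>M\<^esub> y) = x"
  using assms by (simp add: a_minus_def M.a_ac M.r_neg)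

lemma smult_commute:
  assumes "a \<in> carrier R" "b \<in> carrier R" "x \<in> carrier M"
  shows "a \<odot>\<^bsub>M\<^esub> (b \<odot>\<^bsub>M\<^esub> x) = b \<odot>\<^bsub>M\<^esub> (a \<odot>\<^bsub>M\<^esub> x)"
  using assms by (metis R.m_comm smult_assoc1)

lemma mem_submodule_if_diff_mem:
  assumes "submodule N R M" "y \<in> N" "x \<in> carrier M" "x \<ominus>\<^bsub>M\<^esub> y \<in> N"
  shows "x \<in> N"
  using assms add_diff_cancel submoduleE(5) submodule_carrier by metis

text \<open>A finitely generated module over a Noetherian ring is Noetherian. By induction on the generators:
for a new generator \<open>a\<close> and the span \<open>G\<close> of the others, a chain \<open>W\<close> is controlled by the chain of
submodules \<open>W k \<inter> G\<close> and the chain of ideals \<open>C k\<close> of the possible coefficients of \<open>a\<close>.\<close>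
lemma submodule_chain_stabilizes:
  assumes "noetherian_ring R" and "finite A" "A \<subseteq> carrier M"
    and "mono W" "\<And>k::nat. submodule (W k) R M" "\<And>k. W k \<subseteq> gen_submodule R M A"
  shows "\<exists>p. \<forall>k\<ge>p. W k = W p"
  using assms(2-)
proof (induction A arbitrary: W rule: finite_induct)
  case empty
  have "W k = {\<zero>\<^bsub>M\<^esub>}" for k
    using empty gen_submodule_least[OF zero_submodule, of "{}"] submodule_zero by blast
  thus ?case by simp
next
  case (insert a A)
  define G where "G = gen_submodule R M A"
  have a: "a \<in> carrier M" and G: "submodule G R M"
    using insert.prems(1) gen_submodule_submodule by (auto simp: G_def)
  note GM = submodule_carrier[OF G]
  have decomp: "\<exists>c\<in>carrier R. \<exists>v\<in>G. x = c \<odot>\<^bsub>M\<^esub> a \<oplus>\<^bsub>M\<^esub> v" if "x \<in> W k" for x k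
  proof -
    let ?S = "{c \<odot>\<^bsub>M\<^esub> a \<oplus>\<^bsub>M\<^esub> v | c v. c \<in> carrier R \<and> v \<in> G}"
    have "submodule ?S R M"
    proof (rule submodule_if_closed, goal_cases)
      case 1 show ?case using a GM by auto
    next
      case 2
      have "\<zero>\<^bsub>M\<^esub> = \<zero> \<odot>\<^bsub>M\<^esub> a \<oplus>\<^bsub>M\<^esub> \<zero>\<^bsub>M\<^esub>" using a by simp
      thus ?case using submodule_zero[OF G] by blast
    next
      case (3 x y)
      then obtain c v d w where *: "c \<in> carrier R" "v \<in> G" "x = c \<odot>\<^bsub>M\<^esub> a \<oplus>\<^bsub>M\<^esub> v"
        "d \<in> carrier R" "w \<in> G" "y = d \<odot>\<^bsub>M\<^esub> a \<oplus>\<^bsub>M\<^esub> w" by blast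
      have "x \<oplus>\<^bsub>M\<^esub> y = (c \<oplus> d) \<odot>\<^bsub>M\<^esub> a \<oplus>\<^bsub>M\<^esub> (v \<oplus>\<^bsub>M\<^esub> w)"
        using * a GM by (simp add: smult_l_distr M.a_ac)
      thus ?case using * submoduleE(5)[OF G] by blast
    next
      case (4 b x)
      then obtain c v where *: "c \<in> carrier R" "v \<in> G" "x = c \<odot>\<^bsub>M\<^esub> a \<oplus>\<^bsub>M\<^esub> v" by blast
      have "b \<odot>\<^bsub>M\<^esub> x = (b \<otimes> c) \<odot>\<^bsub>M\<^esub> a \<oplus>\<^bsub>M\<^esub> (b \<odot>\<^bsub>M\<^esub> v)"
        using * 4 a GM by (simp add: smult_r_distr smult_assoc1)
      thus ?case using * 4 submoduleE(4)[OF G] by blast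
    qed
    moreover have "insert a A \<subseteq> ?S"
    proof -
      have "a = \<one> \<odot>\<^bsub>M\<^esub> a \<oplus>\<^bsub>M\<^esub> \<zero>\<^bsub>M\<^esub>" using a by simp
      hence "a \<in> ?S" using submodule_zero[OF G] by blast
      moreover have "v \<in> ?S" if "v \<in> G" for v
      proof -
        have "v = \<zero> \<odot>\<^bsub>M\<^esub> a \<oplus>\<^bsub>M\<^esub> v" using a GM[OF that] by simp
        thus ?thesis using that by blast
      qed
      ultimately show ?thesis using gen_submodule_incl[of A] by (auto simp: G_def)
    qed
    ultimately show ?thesis using gen_submodule_least insert.prems(4) that by blast
  qed
  define C where "C k = {c \<in> carrier R. \<exists>v\<in>G. c \<odot>\<^bsub>M\<^esub> a \<oplus>\<^bsub>M\<^esub> v \<in> W k}" for k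
  have "ideal (C k) R" for k
  proof (rule ideal_if_closed, goal_cases)
    case 1 show ?case by (auto simp: C_def)
  next
    case 2 
    show ?case using a submodule_zero[OF G] submodule_zero[OF insert.prems(3)] 
      by (auto simp: C_def intro!: bexI[of _ "\<zero>\<^bsub>M\<^esub>"])
  next
    case (3 x y)
    then obtain v w where *: "x \<in> carrier R" "y \<in> carrier R" "v \<in> G" "w \<in> G"
      "x \<odot>\<^bsub>M\<^esub> a \<oplus>\<^bsub>M\<^esub> v \<in> W k" "y \<odot>\<^bsub>M\<^esub> a \<oplus>\<^bsub>M\<^esub> w \<in> W k" by (auto simp: C_def)
    have "(x \<oplus> y) \<odot>\<^bsub>M\<^esub> a \<oplus>\<^bsub>M\<^esub> (v \<oplus>\<^bsub>M\<^esub> w) 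
        = (x \<odot>\<^bsub>M\<^esub> a \<oplus>\<^bsub>M\<^esub> v) \<oplus>\<^bsub>M\<^esub> (y \<odot>\<^bsub>M\<^esub> a \<oplus>\<^bsub>M\<^esub> w)"
      using * a GM by (simp add: smult_l_distr M.a_ac)
    hence "(x \<oplus> y) \<odot>\<^bsub>M\<^esub> a \<oplus>\<^bsub>M\<^esub> (v \<oplus>\<^bsub>M\<^esub> w) \<in> W k"
      using * submoduleE(5)[OF insert.prems(3)] by simp
    thus ?case using * submoduleE(5)[OF G] by (auto simp: C_def)
  next
    case (4 b x)
    then obtain v where *: "x \<in> carrier R" "v \<in> G" "x \<odot>\<^bsub>M\<^esub> a \<oplus>\<^bsub>M\<^esub> v \<in> W k"
      by (auto simp: C_def)
    have "(b \<otimes> x) \<odot>\<^bsub>M\<^esub> a \<oplus>\<^bsub>M\<^esub> (b \<odot>\<^bsub>M\<^esub> v) = b \<odot>\<^bsub>M\<^esub> (x \<odot>\<^bsub>M\<^esub> a \<oplus>\<^bsub>M\<^esub> v)"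
      using * 4 a GM by (simp add: smult_r_distr smult_assoc1)
    hence "(b \<otimes> x) \<odot>\<^bsub>M\<^esub> a \<oplus>\<^bsub>M\<^esub> (b \<odot>\<^bsub>M\<^esub> v) \<in> W k"
      using * 4 submoduleE(4)[OF insert.prems(3)] by simp
    thus ?case using * 4 submoduleE(4)[OF G] by (auto simp: C_def)
  qed
  moreover have "mono C"
    using monoD[OF insert.prems(2)] by (fastforce intro!: monoI simp: C_def)
  ultimately obtain p where p: "\<And>k. k \<ge> p \<Longrightarrow> C k = C p"
    using noetherian_ring.ideal_chain_stabilizes[OF assms(1)] by metis
  have "\<exists>q. \<forall>k\<ge>q. W k \<inter> G = W q \<inter> G"
  proof (rule insert.IH)
    show "A \<subseteq> carrier M" using insert.prems by simp
    show "mono (\<lambda>k. W k \<inter> G)" using monoD[OF insert.prems(2)] by (auto intro!: monoI)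
    show "submodule (W k \<inter> G) R M" for k
      using submodule_Int[OF insert.prems(3) G] .
  qed (simp add: G_def)
  then obtain q where q: "\<And>k. k \<ge> q \<Longrightarrow> W k \<inter> G = W q \<inter> G" by blast
  have "W k = W (max p q)" if k: "max p q \<le> k" for k
  proof
    show "W (max p q) \<subseteq> W k" using monoD[OF insert.prems(2) k] .
    show "W k \<subseteq> W (max p q)"
    proof
      fix x assume x: "x \<in> W k"
      then obtain c v where cv: "c \<in> carrier R" "v \<in> G" "x = c \<odot>\<^bsub>M\<^esub> a \<oplus>\<^bsub>M\<^esub> v"
        using decomp by blast
      hence "c \<in> C (max p q)" using x p[of k] p[of "max p q"] k by (auto simp: C_def)
      then obtain w where w: "w \<in> G" "c \<odot>\<^bsub>M\<^esub> a \<oplus>\<^bsub>M\<^esub> w \<in> W (max p q)"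
        by (auto simp: C_def)
      hence "x \<ominus>\<^bsub>M\<^esub> (c \<odot>\<^bsub>M\<^esub> a \<oplus>\<^bsub>M\<^esub> w) \<in> W k"
        using submodule_diff[OF insert.prems(3) x] monoD[OF insert.prems(2) k] by blast
      moreover have "x \<ominus>\<^bsub>M\<^esub> (c \<odot>\<^bsub>M\<^esub> a \<oplus>\<^bsub>M\<^esub> w) = v \<ominus>\<^bsub>M\<^esub> w"
        using cv w a GM by (simp add: add_diff_cancel_left)
      ultimately have "x \<ominus>\<^bsub>M\<^esub> (c \<odot>\<^bsub>M\<^esub> a \<oplus>\<^bsub>M\<^esub> w) \<in> W k \<inter> G"
        using submodule_diff[OF G cv(2) w(1)] by simp
      hence "x \<ominus>\<^bsub>M\<^esub> (c \<odot>\<^bsub>M\<^esub> a \<oplus>\<^bsub>M\<^esub> w) \<in> W (max p q)"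
        using q[of k] q[of "max p q"] k by auto
      thus "x \<in> W (max p q)"
        using mem_submodule_if_diff_mem[OF insert.prems(3) w(2)] submodule_carrier[OF insert.prems(3) x] by blast
    qed
  qed
  thus ?case by blast
qed

end

section \<open>Graded submodules of the Rees module\<close>

text \<open>For a list \<open>as\<close> that generates an ideal \<open>J\<close>, this is \<open>J\<^sup>n M\<close>. The last equation is
\<open>(a, as)\<^sup>n\<^sup>+\<^sup>1 M = (as)\<^sup>n\<^sup>+\<^sup>1 M + a (a, as)\<^sup>n M\<close>; this recursion, unlike a list of monomials,
supports an induction on the number of generators.\<close>
fun power_span :: "('a, 'b, 'm) module_scheme \<Rightarrow> 'a list \<Rightarrow> nat \<Rightarrow> 'b set" where
  "power_span M [] 0 = carrier M"
| "power_span M [] (Suc n) = {\<zero>\<^bsub>M\<^esub>}"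
| "power_span M (a # as) 0 = carrier M"
| "power_span M (a # as) (Suc n) =
     {u \<oplus>\<^bsub>M\<^esub> a \<odot>\<^bsub>M\<^esub> v | u v. u \<in> power_span M as (Suc n) \<and> v \<in> power_span M (a # as) n}"

text \<open>A graded submodule \<open>\<Oplus>\<^sub>n U n\<close> of the Rees module \<open>\<Oplus>\<^sub>n (as)\<^sup>n M\<close>, given by its components. The
elements of \<open>as\<close> act as the degree one variables of the Rees algebra.\<close>
definition graded_family ::
    "('a, 'r) ring_scheme \<Rightarrow> ('a, 'b, 'm) module_scheme \<Rightarrow> 'a list \<Rightarrow> (nat \<Rightarrow> 'b set) \<Rightarrow> bool" where
  "graded_family R M as U \<longleftrightarrow> (\<forall>n. submodule (U n) R M \<and> U n \<subseteq> power_span M as n \<and>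
     (\<forall>a\<in>set as. \<forall>u\<in>U n. a \<odot>\<^bsub>M\<^esub> u \<in> U (Suc n)))"

text \<open>The colon of a graded submodule by the variable \<open>a\<close>. Its \<open>d\<close>-fold iterate records the multiples of
\<open>a\<^sup>d\<close> in \<open>U\<close>.\<close>
definition colon_family ::
    "('a, 'b, 'm) module_scheme \<Rightarrow> 'a \<Rightarrow> 'a list \<Rightarrow> (nat \<Rightarrow> 'b set) \<Rightarrow> nat \<Rightarrow> 'b set" where
  "colon_family M a as U n = {w \<in> power_span M (a # as) n. a \<odot>\<^bsub>M\<^esub> w \<in> U (Suc n)}"

text \<open>The part free of \<open>a\<close> that occurs in an element of \<open>U\<close>, as in the proof of Hilbert's basis
theorem, but with the lowest power of \<open>a\<close> in the place of the highest. An element of degree \<open>0\<close> is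
its own trailing part. The trailing parts of the iterated colons correspond to the ideals of leading
coefficients in given degrees of the variable.\<close>
fun trailing_family ::
    "('a, 'b, 'm) module_scheme \<Rightarrow> 'a \<Rightarrow> 'a list \<Rightarrow> (nat \<Rightarrow> 'b set) \<Rightarrow> nat \<Rightarrow> 'b set" where
  "trailing_family M a as U 0 = U 0"
| "trailing_family M a as U (Suc n) =
     {u \<in> power_span M as (Suc n). \<exists>v\<in>power_span M (a # as) n. u \<oplus>\<^bsub>M\<^esub> a \<odot>\<^bsub>M\<^esub> v \<in> U (Suc n)}"

context module
begin

lemma power_span_0: "power_span M as 0 = carrier M"
  by (cases as) auto

lemma graded_familyD:
  assumes "graded_family R M as U"
  shows "submodule (U n) R M" "u \<in> U n \<Longrightarrow> u \<in> power_span M as n"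
    "a \<in> set as \<Longrightarrow> u \<in> U n \<Longrightarrow> a \<odot>\<^bsub>M\<^esub> u \<in> U (Suc n)"
  using assms by (auto simp: graded_family_def)

text \<open>The next two lemmas let sums and multiples pass through the normal form \<open>u + a v\<close>.\<close>
lemma lin_comb_add:
  assumes "a \<in> carrier R" "u \<in> carrier M" "v \<in> carrier M" "u' \<in> carrier M" "v' \<in> carrier M"
  shows "(u \<oplus>\<^bsub>M\<^esub> u') \<oplus>\<^bsub>M\<^esub> a \<odot>\<^bsub>M\<^esub> (v \<oplus>\<^bsub>M\<^esub> v') = (u \<oplus>\<^bsub>M\<^esub> a \<odot>\<^bsub>M\<^esub> v) \<oplus>\<^bsub>M\<^esub> (u' \<oplus>\<^bsub>M\<^esub> a \<odot>\<^bsub>M\<^esub> v')"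
  using assms by (simp add: smult_r_distr M.a_ac)

lemma lin_comb_smult:
  assumes "a \<in> carrier R" "b \<in> carrier R" "u \<in> carrier M" "v \<in> carrier M"
  shows "b \<odot>\<^bsub>M\<^esub> (u \<oplus>\<^bsub>M\<^esub> a \<odot>\<^bsub>M\<^esub> v) = b \<odot>\<^bsub>M\<^esub> u \<oplus>\<^bsub>M\<^esub> a \<odot>\<^bsub>M\<^esub> (b \<odot>\<^bsub>M\<^esub> v)"
  using assms smult_commute[of b a v] by (simp add: smult_r_distr)

lemma power_span_submodule:
  "set as \<subseteq> carrier R \<Longrightarrow> submodule (power_span M as n) R M"
proof (induction as arbitrary: n)
  case Nil
  show ?case by (cases n) (simp_all add: carrier_is_submodule zero_submodule)
next
  case (Cons a as)
  show ?case
  proof (induction n)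
    case 0
    show ?case by (simp add: carrier_is_submodule)
  next
    case (Suc n)
    let ?P = "power_span M as (Suc n)" and ?Q = "power_span M (a # as) n"
    have P: "submodule ?P R M" and Q: "submodule ?Q R M" and a: "a \<in> carrier R"
      using Cons Suc by auto
    note PM = submodule_carrier[OF P] and QM = submodule_carrier[OF Q]
    show ?case unfolding power_span.simps
    proof (rule submodule_if_closed, goal_cases)
      case 1 show ?case using a PM QM by auto
    next
      case 2
      have "\<zero>\<^bsub>M\<^esub> = \<zero>\<^bsub>M\<^esub> \<oplus>\<^bsub>M\<^esub> a \<odot>\<^bsub>M\<^esub> \<zero>\<^bsub>M\<^esub>" using a by simp
      thus ?case using submodule_zero[OF P] submodule_zero[OF Q] by blast
    next
      case (3 x y)
      then obtain u v u' v' where *: "u \<in> ?P" "v \<in> ?Q" "x = u \<oplus>\<^bsub>M\<^esub> a \<odot>\<^bsub>M\<^esub> v"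
        "u' \<in> ?P" "v' \<in> ?Q" "y = u' \<oplus>\<^bsub>M\<^esub> a \<odot>\<^bsub>M\<^esub> v'" by blast
      have "x \<oplus>\<^bsub>M\<^esub> y = (u \<oplus>\<^bsub>M\<^esub> u') \<oplus>\<^bsub>M\<^esub> a \<odot>\<^bsub>M\<^esub> (v \<oplus>\<^bsub>M\<^esub> v')"
        using * a PM QM by (simp add: lin_comb_add)
      thus ?case using * submoduleE(5)[OF P] submoduleE(5)[OF Q] by blast
    next
      case (4 b x)
      then obtain u v where *: "u \<in> ?P" "v \<in> ?Q" "x = u \<oplus>\<^bsub>M\<^esub> a \<odot>\<^bsub>M\<^esub> v" by blast
      have "b \<odot>\<^bsub>M\<^esub> x = b \<odot>\<^bsub>M\<^esub> u \<oplus>\<^bsub>M\<^esub> a \<odot>\<^bsub>M\<^esub> (b \<odot>\<^bsub>M\<^esub> v)"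
        using * a 4 PM QM by (simp add: lin_comb_smult)
      thus ?case using * 4 submoduleE(4)[OF P] submoduleE(4)[OF Q] by blast
    qed
  qed
qed

lemma power_span_Cons_incl:
  assumes "set (a # as) \<subseteq> carrier R" "u \<in> power_span M as n"
  shows "u \<in> power_span M (a # as) n"
proof (cases n)
  case 0
  thus ?thesis using assms power_span_0 by simp
next
  case (Suc m)
  note P = power_span_submodule[of as n]
  have "u = u \<oplus>\<^bsub>M\<^esub> a \<odot>\<^bsub>M\<^esub> \<zero>\<^bsub>M\<^esub>"
    using assms submodule_carrier[OF P] by simp
  thus ?thesis
    using assms(2) Suc submodule_zero[OF power_span_submodule[OF assms(1)], of m]
    unfolding Suc power_span.simps by blast
qed

lemma power_span_smult_hd:
  assumes "set (a # as) \<subseteq> carrier R" "v \<in> power_span M (a # as) n"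
  shows "a \<odot>\<^bsub>M\<^esub> v \<in> power_span M (a # as) (Suc n)"
proof -
  have "a \<odot>\<^bsub>M\<^esub> v = \<zero>\<^bsub>M\<^esub> \<oplus>\<^bsub>M\<^esub> a \<odot>\<^bsub>M\<^esub> v"
    using assms submodule_carrier[OF power_span_submodule[OF assms(1)]] by simp
  moreover have "\<zero>\<^bsub>M\<^esub> \<in> power_span M as (Suc n)"
    using submodule_zero[OF power_span_submodule] assms(1) by simp
  ultimately show ?thesis using assms(2) by (subst power_span.simps) blast
qed

lemma power_span_smult:
  assumes "set as \<subseteq> carrier R" "b \<in> set as" "x \<in> power_span M as n"
  shows "b \<odot>\<^bsub>M\<^esub> x \<in> power_span M as (Suc n)"
  using assms
proof (induction as arbitrary: n x)
  case (Cons a as)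
  have as: "set as \<subseteq> carrier R" and a: "a \<in> carrier R" using Cons.prems(1) by auto
  show ?case
  proof (cases "b = a")
    case True
    thus ?thesis using power_span_smult_hd Cons.prems by blast
  next
    case False
    hence b: "b \<in> set as" "b \<in> carrier R" using Cons.prems as by auto
    from Cons.prems(3) show ?thesis
    proof (induction n arbitrary: x)
      case 0
      hence "b \<odot>\<^bsub>M\<^esub> x \<in> power_span M as (Suc 0)"
        using Cons.IH[OF as b(1)] power_span_0 by simp
      thus ?case by (rule power_span_Cons_incl[OF Cons.prems(1)])
    next
      case (Suc n)
      then obtain u v where *: "u \<in> power_span M as (Suc n)" "v \<in> power_span M (a # as) n"
        "x = u \<oplus>\<^bsub>M\<^esub> a \<odot>\<^bsub>M\<^esub> v" by auto
      have "b \<odot>\<^bsub>M\<^esub> x = b \<odot>\<^bsub>M\<^esub> u \<oplus>\<^bsub>M\<^esub> a \<odot>\<^bsub>M\<^esub> (b \<odot>\<^bsub>M\<^esub> v)"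
        using * a b submodule_carrier[OF power_span_submodule[OF as]]
          submodule_carrier[OF power_span_submodule[OF Cons.prems(1)]] by (simp add: lin_comb_smult)
      thus ?case
        using Cons.IH[OF as b(1) *(1)] Suc.IH[OF *(2)] by (subst power_span.simps) blast
    qed
  qed
qed simp

lemma colon_family_graded:
  assumes as: "set (a # as) \<subseteq> carrier R" and U: "graded_family R M (a # as) U"
  shows "graded_family R M (a # as) (colon_family M a as U)"
    and "U \<le> colon_family M a as U"
proof -
  note P = power_span_submodule[OF as]
  have a: "a \<in> carrier R" using as by simp
  have "submodule (colon_family M a as U n) R M" for n
  proof -
    have eq: "colon_family M a as U n
        = power_span M (a # as) n \<inter> {x \<in> carrier M. \<forall>b\<in>{a}. b \<odot>\<^bsub>M\<^esub> x \<in> U (Suc n)}"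
      using submodule_carrier[OF P] by (auto simp: colon_family_def)
    show ?thesis unfolding eq
      by (rule submodule_Int[OF P colon_submodule[OF graded_familyD(1)[OF U]]]) (use a in simp)
  qed
  moreover have "b \<odot>\<^bsub>M\<^esub> u \<in> colon_family M a as U (Suc n)"
    if "b \<in> set (a # as)" "u \<in> colon_family M a as U n" for b u n
  proof -
    have u: "u \<in> power_span M (a # as) n" "a \<odot>\<^bsub>M\<^esub> u \<in> U (Suc n)"
      using that by (auto simp: colon_family_def)
    have b: "b \<in> carrier R" using that as by blast
    have "a \<odot>\<^bsub>M\<^esub> (b \<odot>\<^bsub>M\<^esub> u) = b \<odot>\<^bsub>M\<^esub> (a \<odot>\<^bsub>M\<^esub> u)"
      by (rule smult_commute[OF a b submodule_carrier[OF P u(1)]])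
    thus ?thesis
      using graded_familyD(3)[OF U that(1) u(2)] power_span_smult[OF as that(1) u(1)]
      by (simp add: colon_family_def del: power_span.simps)
  qed
  ultimately show "graded_family R M (a # as) (colon_family M a as U)"
    unfolding graded_family_def by (auto simp: colon_family_def simp del: power_span.simps)
  show "U \<le> colon_family M a as U"
    using graded_familyD[OF U] by (auto simp: le_fun_def colon_family_def simp del: power_span.simps)
qed

lemma trailing_family_graded:
  assumes as: "set (a # as) \<subseteq> carrier R" and U: "graded_family R M (a # as) U"
  shows "graded_family R M as (trailing_family M a as U)"
proof -
  note P = power_span_submodule[of as] and Q = power_span_submodule[OF as]
  have a: "a \<in> carrier R" and as': "set as \<subseteq> carrier R" using as by auto
  note PM = submodule_carrier[OF P[OF as']] and QM = submodule_carrier[OF Q]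
    and US = graded_familyD(1)[OF U]
  have sub: "submodule (trailing_family M a as U n) R M" for n
  proof (cases n)
    case 0
    thus ?thesis using US by simp
  next
    case (Suc m)
    show ?thesis unfolding Suc trailing_family.simps
    proof (rule submodule_if_closed, goal_cases)
      case 1 show ?case using PM by auto
    next
      case 2
      have "\<zero>\<^bsub>M\<^esub> \<oplus>\<^bsub>M\<^esub> a \<odot>\<^bsub>M\<^esub> \<zero>\<^bsub>M\<^esub> \<in> U (Suc m)" using a submodule_zero[OF US] by simp
      thus ?case using submodule_zero[OF P[OF as']] submodule_zero[OF Q] by blast
    next
      case (3 x y)
      then obtain v w where *: "x \<in> power_span M as (Suc m)" "y \<in> power_span M as (Suc m)"
        "v \<in> power_span M (a # as) m" "w \<in> power_span M (a # as) m"
        "x \<oplus>\<^bsub>M\<^esub> a \<odot>\<^bsub>M\<^esub> v \<in> U (Suc m)" "y \<oplus>\<^bsub>M\<^esub> a \<odot>\<^bsub>M\<^esub> w \<in> U (Suc m)" by blast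
      hence "(x \<oplus>\<^bsub>M\<^esub> y) \<oplus>\<^bsub>M\<^esub> a \<odot>\<^bsub>M\<^esub> (v \<oplus>\<^bsub>M\<^esub> w) \<in> U (Suc m)"
        using submoduleE(5)[OF US] a PM QM by (simp add: lin_comb_add del: power_span.simps)
      thus ?case using * submoduleE(5)[OF P[OF as']] submoduleE(5)[OF Q] by blast
    next
      case (4 b x)
      then obtain v where *: "x \<in> power_span M as (Suc m)" "v \<in> power_span M (a # as) m"
        "x \<oplus>\<^bsub>M\<^esub> a \<odot>\<^bsub>M\<^esub> v \<in> U (Suc m)" by blast
      have "b \<odot>\<^bsub>M\<^esub> (x \<oplus>\<^bsub>M\<^esub> a \<odot>\<^bsub>M\<^esub> v) \<in> U (Suc m)" using submoduleE(4)[OF US] 4 * by blast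
      hence "b \<odot>\<^bsub>M\<^esub> x \<oplus>\<^bsub>M\<^esub> a \<odot>\<^bsub>M\<^esub> (b \<odot>\<^bsub>M\<^esub> v) \<in> U (Suc m)"
        using * 4 a PM QM by (simp add: lin_comb_smult del: power_span.simps)
      thus ?case using * 4 submoduleE(4)[OF P[OF as']] submoduleE(4)[OF Q] by blast
    qed
  qed
  have span: "trailing_family M a as U n \<subseteq> power_span M as n" for n
    by (cases n) (use submodule_carrier[OF US] power_span_0 in auto)
  have "b \<odot>\<^bsub>M\<^esub> u \<in> trailing_family M a as U (Suc n)"
    if b: "b \<in> set as" and u: "u \<in> trailing_family M a as U n" for b u n
  proof -
    have bR: "b \<in> carrier R" and b': "b \<in> set (a # as)" using b as by auto
    have uP: "u \<in> power_span M as n" using u span by blast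
    hence uM: "u \<in> carrier M" using PM by blast
    have bu: "b \<odot>\<^bsub>M\<^esub> u \<in> power_span M as (Suc n)"
      using power_span_smult[OF as' b uP] .
    have "\<exists>v\<in>power_span M (a # as) n. b \<odot>\<^bsub>M\<^esub> u \<oplus>\<^bsub>M\<^esub> a \<odot>\<^bsub>M\<^esub> v \<in> U (Suc n)"
    proof (cases n)
      case 0
      hence "b \<odot>\<^bsub>M\<^esub> u \<oplus>\<^bsub>M\<^esub> a \<odot>\<^bsub>M\<^esub> \<zero>\<^bsub>M\<^esub> \<in> U (Suc n)"
        using u graded_familyD(3)[OF U b', of u 0] a bR uM by simp
      thus ?thesis using submodule_zero[OF Q] by blast
    next
      case (Suc m)
      then obtain v where v: "v \<in> power_span M (a # as) m" "u \<oplus>\<^bsub>M\<^esub> a \<odot>\<^bsub>M\<^esub> v \<in> U (Suc m)"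
        using u by auto
      have "b \<odot>\<^bsub>M\<^esub> (u \<oplus>\<^bsub>M\<^esub> a \<odot>\<^bsub>M\<^esub> v) \<in> U (Suc n)"
        using graded_familyD(3)[OF U b' v(2)] Suc by simp
      hence "b \<odot>\<^bsub>M\<^esub> u \<oplus>\<^bsub>M\<^esub> a \<odot>\<^bsub>M\<^esub> (b \<odot>\<^bsub>M\<^esub> v) \<in> U (Suc n)"
        using a bR uM QM[OF v(1)] by (simp add: lin_comb_smult)
      thus ?thesis using power_span_smult[OF as b' v(1)] Suc by blast
    qed
    thus ?thesis using bu by simp
  qed
  thus ?thesis using sub span by (auto simp: graded_family_def)
qed

lemma trailing_family_mono:
  "U \<le> V \<Longrightarrow> trailing_family M a as U \<le> trailing_family M a as V"
proof (rule le_funI)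
  fix n assume "U \<le> V"
  thus "trailing_family M a as U n \<le> trailing_family M a as V n"
    by (cases n) (auto dest: le_funD)
qed

lemma colon_family_mono:
  "U \<le> V \<Longrightarrow> colon_family M a as U \<le> colon_family M a as V"
  by (auto simp: le_fun_def colon_family_def)

lemma iterated_colon_family_graded:
  assumes "set (a # as) \<subseteq> carrier R" "graded_family R M (a # as) U"
  shows "graded_family R M (a # as) ((colon_family M a as ^^ d) U)"
  by (induction d) (use assms colon_family_graded(1) in auto)

text \<open>A graded submodule is determined, among those that contain it, by all its trailing families. By
induction on the degree: an element \<open>u + a v\<close> of \<open>V\<close> has the same trailing part as some
\<open>u + a w\<close> in \<open>U\<close>, and their difference \<open>a (v - w)\<close> puts \<open>v - w\<close> into the colon of \<open>V\<close> by \<open>a\<close>, one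
degree lower. The colons again satisfy the hypotheses, with \<open>d\<close> shifted by one.\<close>
lemma graded_family_le_if_trailing_le:
  assumes as: "set (a # as) \<subseteq> carrier R"
    and "graded_family R M (a # as) U" "graded_family R M (a # as) V" "U \<le> V"
    and "\<And>d. trailing_family M a as ((colon_family M a as ^^ d) V)
            \<le> trailing_family M a as ((colon_family M a as ^^ d) U)"
  shows "V n \<subseteq> U n"
  using assms(2-)
proof (induction n arbitrary: U V)
  case 0
  show ?case using le_funD[OF "0.prems"(4)[of 0], of 0] by simp
next
  case (Suc n)
  note US = graded_familyD[OF Suc.prems(1)] and VS = graded_familyD[OF Suc.prems(2)]
  note Q = power_span_submodule[OF as]
  note QM = submodule_carrier[OF Q]
  have a: "a \<in> carrier R" and as': "set as \<subseteq> carrier R" using as by auto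
  have shift: "colon_family M a as V n \<subseteq> colon_family M a as U n"
  proof (rule Suc.IH)
    show "graded_family R M (a # as) (colon_family M a as U)"
      and "graded_family R M (a # as) (colon_family M a as V)"
      using colon_family_graded(1)[OF as] Suc.prems(1,2) by blast+
    show "colon_family M a as U \<le> colon_family M a as V"
      by (rule colon_family_mono[OF Suc.prems(3)])
    show "trailing_family M a as ((colon_family M a as ^^ d) (colon_family M a as V))
        \<le> trailing_family M a as ((colon_family M a as ^^ d) (colon_family M a as U))" for d
      using Suc.prems(4)[of "Suc d"] by (simp add: funpow_swap1)
  qed
  show ?case
  proof
    fix f assume f: "f \<in> V (Suc n)"
    then obtain u v where uv: "u \<in> power_span M as (Suc n)" "v \<in> power_span M (a # as) n"
      "f = u \<oplus>\<^bsub>M\<^esub> a \<odot>\<^bsub>M\<^esub> v" using VS(2)[OF f] by auto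
    hence "u \<in> trailing_family M a as V (Suc n)" using f by auto
    hence "u \<in> trailing_family M a as U (Suc n)"
      using le_funD[OF Suc.prems(4)[of 0], of "Suc n"] by auto
    then obtain w where w: "w \<in> power_span M (a # as) n" "u \<oplus>\<^bsub>M\<^esub> a \<odot>\<^bsub>M\<^esub> w \<in> U (Suc n)" by auto
    have M: "u \<in> carrier M" "v \<in> carrier M" "w \<in> carrier M"
      using submodule_carrier[OF power_span_submodule[OF as'] uv(1)] QM uv(2) w(1) by auto
    have eq: "f \<ominus>\<^bsub>M\<^esub> (u \<oplus>\<^bsub>M\<^esub> a \<odot>\<^bsub>M\<^esub> w) = a \<odot>\<^bsub>M\<^esub> (v \<ominus>\<^bsub>M\<^esub> w)"
      using uv(3) a M by (simp add: add_diff_cancel_left smult_diff)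
    have "u \<oplus>\<^bsub>M\<^esub> a \<odot>\<^bsub>M\<^esub> w \<in> V (Suc n)" using w(2) le_funD[OF Suc.prems(3)] by blast
    hence "a \<odot>\<^bsub>M\<^esub> (v \<ominus>\<^bsub>M\<^esub> w) \<in> V (Suc n)"
      using submodule_diff[OF VS(1) f] eq by metis
    hence "v \<ominus>\<^bsub>M\<^esub> w \<in> colon_family M a as V n"
      using submodule_diff[OF Q uv(2) w(1)] by (simp add: colon_family_def)
    hence "a \<odot>\<^bsub>M\<^esub> (v \<ominus>\<^bsub>M\<^esub> w) \<in> U (Suc n)" using shift by (auto simp: colon_family_def)
    thus "f \<in> U (Suc n)"
      using mem_submodule_if_diff_mem[OF US(1) w(2)] eq submodule_carrier[OF VS(1) f] by simp
  qed
qed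

text \<open>The Rees module is Noetherian as a graded module, in the form of Hilbert's basis theorem, by
induction on the number of variables. The trailing families of all iterated colons form a double
chain of graded submodules in one variable less, which stabilizes uniformly.\<close>
theorem graded_chain_stabilizes:
  assumes noeth: "noetherian_ring R" and fg: "finite A" "A \<subseteq> carrier M" "carrier M = gen_submodule R M A"
    and "set as \<subseteq> carrier R" "mono W" "\<And>k::nat. graded_family R M as (W k)"
  shows "\<exists>p. \<forall>k\<ge>p. W k = W p"
  using assms(5-)
proof (induction as arbitrary: W)
  case Nil
  note WS = graded_familyD[OF Nil.prems(3)]
  have "mono (\<lambda>k. W k 0)" using le_funD[OF monoD[OF Nil.prems(2)]] by (auto intro!: monoI)
  then obtain p where p: "\<And>k. k \<ge> p \<Longrightarrow> W k 0 = W p 0"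
    using submodule_chain_stabilizes[OF noeth fg(1,2), of "\<lambda>k. W k 0"] WS(1) 
      submodule_carrier[OF WS(1)] fg(3) by (metis subsetI)
  have "W k (Suc n) = {\<zero>\<^bsub>M\<^esub>}" for k n
  proof
    show "W k (Suc n) \<subseteq> {\<zero>\<^bsub>M\<^esub>}" using WS(2)[of _ k "Suc n"] by auto
    show "{\<zero>\<^bsub>M\<^esub>} \<subseteq> W k (Suc n)" using submodule_zero[OF WS(1)] by blast
  qed
  hence "W k n = W p n" if "k \<ge> p" for k n
    using p[OF that] by (cases n) auto
  thus ?case by blast
next
  case (Cons a as)
  note c = colon_family_graded[OF Cons.prems(1)] 
    iterated_colon_family_graded[OF Cons.prems(1) Cons.prems(3)]
  define L where "L d k = trailing_family M a as ((colon_family M a as ^^ d) (W k))" for d k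
  have "\<exists>p. \<forall>k\<ge>p. \<forall>d. L d k = L d p"
  proof (rule double_chain_stabilizes)
    show "mono (\<lambda>d. L d k)" for k
      unfolding mono_iff_le_Suc L_def using c(2,3) by (auto intro!: trailing_family_mono)
    show "mono (L d)" for d
    proof (rule monoI)
      fix k l :: nat assume "k \<le> l"
      hence "(colon_family M a as ^^ d) (W k) \<le> (colon_family M a as ^^ d) (W l)"
        by (induction d) (use monoD[OF Cons.prems(2)] in \<open>auto intro!: colon_family_mono\<close>)
      thus "L d k \<le> L d l" unfolding L_def by (rule trailing_family_mono)
    qed
    fix V assume V: "mono V" "\<And>k::nat. \<exists>d j. V k = L d j"
    have "graded_family R M as (V k)" for k
      using V(2)[of k] trailing_family_graded[OF Cons.prems(1) c(3)] by (auto simp: L_def)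
    thus "\<exists>p. \<forall>k\<ge>p. V k = V p" using Cons.IH[OF _ V(1)] Cons.prems(1) by simp
  qed
  then obtain p where p: "\<And>k d. k \<ge> p \<Longrightarrow> L d k = L d p" by blast
  have "W k = W p" if k: "k \<ge> p" for k
  proof (rule antisym)
    show "W p \<le> W k" using monoD[OF Cons.prems(2) k] .
    show "W k \<le> W p"
      using graded_family_le_if_trailing_le[OF Cons.prems(1) Cons.prems(3) Cons.prems(3) \<open>W p \<le> W k\<close>]
        p[OF k] by (auto simp: L_def intro!: le_funI)
  qed
  thus ?case by blast
qed

end

section \<open>The filtration by the submodules \<open>I\<^sup>n M\<close>\<close>

locale fg_module_with_ideal = module R M for R (structure) and M (structure) +
  fixes I
  assumes noetherian: "noetherian_ring R" and fin_gen: "fin_gen_module R M" and I_ideal: "ideal I R"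
begin

definition Ipow where
  "Ipow n = ideal_pow R I n"

definition IM where
  "IM n = ideal_smult R M (Ipow n) (carrier M)"

lemma Ipow_ideal: "ideal (Ipow n) R"
proof -
  interpret S: comm_monoid "ideals_set R" by (rule R.ideals_set_is_comm_monoid)
  have "I \<in> carrier (ideals_set R)" using I_ideal by (simp add: ideals_set_def)
  hence "Ipow n \<in> carrier (ideals_set R)" unfolding Ipow_def by (rule S.nat_pow_closed)
  thus ?thesis by (simp add: ideals_set_def)
qed

lemma Ipow_carrier: "a \<in> Ipow n \<Longrightarrow> a \<in> carrier R"
  by (rule ideal.Icarr[OF Ipow_ideal])

lemma Ipow_0: "Ipow 0 = carrier R"
  by (simp add: Ipow_def ideals_set_def)

lemma Ipow_add: "Ipow (m + n) = Ipow m \<cdot> Ipow n"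
proof -
  interpret S: comm_monoid "ideals_set R" by (rule R.ideals_set_is_comm_monoid)
  have "I \<in> carrier (ideals_set R)" using I_ideal by (simp add: ideals_set_def)
  hence "Ipow (m + n) = Ipow m \<otimes>\<^bsub>ideals_set R\<^esub> Ipow n" by (simp add: Ipow_def S.nat_pow_mult)
  thus ?thesis by (simp add: ideals_set_def)
qed

lemma Ipow_1: "Ipow 1 = I"
proof -
  interpret S: comm_monoid "ideals_set R" by (rule R.ideals_set_is_comm_monoid)
  have "I \<in> carrier (ideals_set R)" using I_ideal by (simp add: ideals_set_def)
  thus ?thesis by (simp add: Ipow_def)
qed

lemma IM_submodule: "submodule (IM n) R M"
  unfolding IM_def ideal_smult_def by (rule gen_submodule_submodule) (auto intro: Ipow_carrier)

lemma IM_carrier: "x \<in> IM n \<Longrightarrow> x \<in> carrier M"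
  by (rule submodule_carrier[OF IM_submodule])

lemma smult_in_IM: "a \<in> Ipow n \<Longrightarrow> x \<in> carrier M \<Longrightarrow> a \<odot>\<^bsub>M\<^esub> x \<in> IM n"
  unfolding IM_def ideal_smult_def by (rule subsetD[OF gen_submodule_incl]) blast

lemma Ipow_add_smult_in:
  assumes N: "submodule N R M" and x: "x \<in> carrier M"
    and "\<And>a b. a \<in> Ipow m \<Longrightarrow> b \<in> Ipow n \<Longrightarrow> a \<odot>\<^bsub>M\<^esub> (b \<odot>\<^bsub>M\<^esub> x) \<in> N" and "c \<in> Ipow (m + n)"
  shows "c \<odot>\<^bsub>M\<^esub> x \<in> N"
proof -
  have "c \<in> Ipow m \<cdot> Ipow n" using assms(4) Ipow_add by simp
  hence "c \<in> carrier R \<and> c \<odot>\<^bsub>M\<^esub> x \<in> N"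
  proof (induction rule: ideal_prod.induct)
    case (prod a b)
    thus ?case using assms(3)[of a b] x by (simp add: Ipow_carrier smult_assoc1)
  next
    case (sum c d)
    thus ?case using submoduleE(5)[OF N] x by (simp add: smult_l_distr)
  qed
  thus ?thesis by simp
qed

lemma IM_add_least:
  assumes N: "submodule N R M"
    and "\<And>a x. a \<in> Ipow m \<Longrightarrow> x \<in> IM n \<Longrightarrow> a \<odot>\<^bsub>M\<^esub> x \<in> N"
  shows "IM (m + n) \<subseteq> N"
  unfolding IM_def[of "m + n"] ideal_smult_def
proof (rule gen_submodule_least[OF N], safe)
  fix c x assume "c \<in> Ipow (m + n)" "x \<in> carrier M"
  thus "c \<odot>\<^bsub>M\<^esub> x \<in> N" using Ipow_add_smult_in[OF N] assms(2) smult_in_IM by blast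
qed

lemma smult_IM: 
  assumes a: "a \<in> Ipow m" and x: "x \<in> IM n"
  shows "a \<odot>\<^bsub>M\<^esub> x \<in> IM (m + n)"
proof -
  have "IM n \<subseteq> {x \<in> carrier M. \<forall>a\<in>Ipow m. a \<odot>\<^bsub>M\<^esub> x \<in> IM (m + n)}" (is "_ \<subseteq> ?N")
    unfolding IM_def[of n] ideal_smult_def
  proof (rule gen_submodule_least)
    show "submodule ?N R M" using IM_submodule Ipow_carrier by (intro colon_submodule) auto
    have "a \<odot>\<^bsub>M\<^esub> (b \<odot>\<^bsub>M\<^esub> y) \<in> IM (m + n)" if "a \<in> Ipow m" "b \<in> Ipow n" "y \<in> carrier M" for a b y
    proof -
      have "a \<otimes> b \<in> Ipow (m + n)" using that Ipow_add ideal_prod.prod by metis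
      thus ?thesis using smult_in_IM[of "a \<otimes> b" "m + n" y] that by (simp add: Ipow_carrier smult_assoc1)
    qed
    thus "{b \<odot>\<^bsub>M\<^esub> y | b y. b \<in> Ipow n \<and> y \<in> carrier M} \<subseteq> ?N" using Ipow_carrier by auto
  qed
  thus ?thesis using a x by blast
qed

lemma IM_antimono: "n \<le> m \<Longrightarrow> IM m \<subseteq> IM n"
  using IM_add_least[OF IM_submodule, of "m - n" n n] submoduleE(4)[OF IM_submodule] Ipow_carrier by simp

lemma ideal_generators:
  assumes "ideal J R"
  obtains bs where "set bs \<subseteq> J" "\<And>K. ideal K R \<Longrightarrow> set bs \<subseteq> K \<Longrightarrow> J \<subseteq> K"
proof -
  obtain B where B: "B \<subseteq> carrier R" "finite B" "J = Idl B"
    using noetherian_ring.finetely_gen[OF noetherian assms] by blast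
  obtain bs where "set bs = B" using finite_list[OF B(2)] by blast
  thus ?thesis using that[of bs] B R.genideal_self[OF B(1)] R.genideal_minimal by blast
qed

lemma IM_subset_power_span:
  assumes "set bs \<subseteq> I" "\<And>K. ideal K R \<Longrightarrow> set bs \<subseteq> K \<Longrightarrow> I \<subseteq> K"
  shows "IM n \<subseteq> power_span M bs n"
proof (induction n)
  case 0
  show ?case using IM_carrier power_span_0 by blast
next
  case (Suc n)
  have bs: "set bs \<subseteq> carrier R" using assms(1) ideal.Icarr[OF I_ideal] by blast
  note S = power_span_submodule[OF bs]
  let ?K = "{a \<in> carrier R. \<forall>x\<in>power_span M bs n. a \<odot>\<^bsub>M\<^esub> x \<in> power_span M bs (Suc n)}"
  have "ideal ?K R" by (rule colon_ideal[OF S]) (use submodule_carrier[OF S] in blast)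
  moreover have "set bs \<subseteq> ?K" using bs power_span_smult[OF bs] by blast
  ultimately have "I \<subseteq> ?K" by (rule assms(2))
  hence "IM (1 + n) \<subseteq> power_span M bs (Suc n)"
    using Suc Ipow_1 by (intro IM_add_least[OF S]) auto
  thus ?case by simp
qed

lemma finite_generators:
  obtains A where "finite A" "A \<subseteq> carrier M" "carrier M = gen_submodule R M A"
  using fin_gen by (auto simp: fin_gen_module_def)

section \<open>A uniform colon formula for the ideals \<open>r(I\<^sup>n, M)\<close>\<close>

text \<open>In the associated graded module \<open>\<Oplus>\<^sub>n I\<^sup>n M / I\<^sup>n\<^sup>+\<^sup>1 M\<close>, the elements killed by a power of the
irrelevant ideal live in bounded degrees. The family \<open>Y k\<close> is chosen so that a single application
of the chain condition gives the bound. It increases with \<open>k\<close>; every class of degree \<open>n\<close> killed by the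
\<open>k\<close>-th power of the irrelevant ideal has its representatives in \<open>Y (n + k) n\<close>; and for \<open>n \<ge> K\<close> the
exponent \<open>K - n\<close> is \<open>0\<close>, so that \<open>Y K n\<close> is contained in \<open>I\<^sup>n\<^sup>+\<^sup>1 M\<close>.\<close>
lemma eventually_no_irrelevant_torsion:
  obtains K where "\<And>n k m. n \<ge> K \<Longrightarrow> m \<in> IM n \<Longrightarrow> (\<And>a. a \<in> Ipow k \<Longrightarrow> a \<odot>\<^bsub>M\<^esub> m \<in> IM (n + k + 1))
    \<Longrightarrow> m \<in> IM (n + 1)"
proof -
  obtain bs where bs: "set bs \<subseteq> I" "\<And>K. ideal K R \<Longrightarrow> set bs \<subseteq> K \<Longrightarrow> I \<subseteq> K"
    using ideal_generators[OF I_ideal] by blast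
  obtain A where A: "finite A" "A \<subseteq> carrier M" "carrier M = gen_submodule R M A"
    by (rule finite_generators)
  \<comment> \<open>Multiplication by \<open>I\<^sup>k\<^sup>-\<^sup>n\<close> raises degree \<open>n\<close> to \<open>max n k\<close>, by truncated subtraction; \<open>m\<close> must go one further.\<close>
  define Y where "Y k n = {m \<in> IM n. \<forall>a\<in>Ipow (k - n). a \<odot>\<^bsub>M\<^esub> m \<in> IM (max n k + 1)}" for k n
  have graded: "graded_family R M bs (Y k)" for k
    unfolding graded_family_def
  proof (intro allI conjI ballI)
    fix n
    have "Y k n = IM n \<inter> {m \<in> carrier M. \<forall>a\<in>Ipow (k - n). a \<odot>\<^bsub>M\<^esub> m \<in> IM (max n k + 1)}"
      using IM_carrier by (auto simp: Y_def)
    moreover have "submodule {m \<in> carrier M. \<forall>a\<in>Ipow (k - n). a \<odot>\<^bsub>M\<^esub> m \<in> IM (max n k + 1)} R M"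
      by (rule colon_submodule[OF IM_submodule]) (use Ipow_carrier in blast)
    ultimately show "submodule (Y k n) R M" using submodule_Int[OF IM_submodule] by simp
    show "Y k n \<subseteq> power_span M bs n"
      using IM_subset_power_span[OF bs] by (auto simp: Y_def)
    fix b m assume b: "b \<in> set bs" and m: "m \<in> Y k n"
    have bP: "b \<in> Ipow 1" using b bs(1) unfolding Ipow_1 by blast
    have mF: "m \<in> IM n" using m by (simp add: Y_def)
    have "a \<odot>\<^bsub>M\<^esub> (b \<odot>\<^bsub>M\<^esub> m) \<in> IM (max (Suc n) k + 1)" if a: "a \<in> Ipow (k - Suc n)" for a
    proof (cases "n < k")
      case True
      have "a \<otimes> b \<in> Ipow ((k - Suc n) + 1)" using ideal_prod.prod[OF a bP] Ipow_add[of "k - Suc n" 1] by simp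
      hence "(a \<otimes> b) \<odot>\<^bsub>M\<^esub> m \<in> IM (max n k + 1)" using m True by (simp add: Y_def Suc_diff_Suc)
      thus ?thesis using True a bP mF by (simp add: smult_assoc1 Ipow_carrier IM_carrier max_def)
    next
      case False
      have "\<one> \<odot>\<^bsub>M\<^esub> m \<in> IM (max n k + 1)" using m False Ipow_0 by (auto simp: Y_def)
      hence "m \<in> IM (n + 1)" using False IM_carrier[OF mF] by (simp add: max_def)
      hence "b \<odot>\<^bsub>M\<^esub> m \<in> IM (Suc n + 1)" using smult_IM[OF bP, of m "n + 1"] by simp
      thus ?thesis using False submoduleE(4)[OF IM_submodule] Ipow_carrier[OF a] by (simp add: max_def)
    qed
    moreover have "b \<odot>\<^bsub>M\<^esub> m \<in> IM (Suc n)" using smult_IM[OF bP mF] by simp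
    ultimately show "b \<odot>\<^bsub>M\<^esub> m \<in> Y k (Suc n)" by (simp add: Y_def)
  qed
  have "mono Y"
    unfolding mono_iff_le_Suc
  proof (intro allI le_funI subsetI)
    fix k n m assume m: "m \<in> Y k n"
    hence mF: "m \<in> IM n" by (simp add: Y_def)
    have "a \<odot>\<^bsub>M\<^esub> m \<in> IM (max n (Suc k) + 1)" if a: "a \<in> Ipow (Suc k - n)" for a
    proof (cases "n \<le> k")
      case True
      have "c \<odot>\<^bsub>M\<^esub> (b \<odot>\<^bsub>M\<^esub> m) \<in> IM (Suc k + 1)" if "c \<in> Ipow 1" "b \<in> Ipow (k - n)" for b c
        using smult_IM[OF that(1), of "b \<odot>\<^bsub>M\<^esub> m" "k + 1"] m that(2) True by (simp add: Y_def max_def)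
      moreover have "a \<in> Ipow (1 + (k - n))" using a True by (simp add: Suc_diff_le)
      ultimately have "a \<odot>\<^bsub>M\<^esub> m \<in> IM (Suc k + 1)"
        using Ipow_add_smult_in[OF IM_submodule IM_carrier[OF mF], of 1 "k - n" "Suc k + 1" a] by blast
      thus ?thesis using True by (simp add: max_def)
    next
      case False
      hence "max n (Suc k) = n" "max n k = n" "Suc k - n = k - n" by auto
      thus ?thesis using m a by (simp add: Y_def)
    qed
    thus "m \<in> Y (Suc k) n" using mF by (simp add: Y_def)
  qed
  then obtain K where K: "\<And>k. k \<ge> K \<Longrightarrow> Y k = Y K"
    using graded_chain_stabilizes[of A bs Y] noetherian A graded bs(1) ideal.Icarr[OF I_ideal] by blast
  have "m \<in> IM (n + 1)"
    if n: "n \<ge> K" and m: "m \<in> IM n" and k: "\<And>a. a \<in> Ipow k \<Longrightarrow> a \<odot>\<^bsub>M\<^esub> m \<in> IM (n + k + 1)" for n k m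
  proof -
    have "m \<in> Y (n + k) n" using m k by (simp add: Y_def max_def)
    hence "m \<in> Y n n" using K[of "n + k"] K[of n] n by simp
    hence "\<one> \<odot>\<^bsub>M\<^esub> m \<in> IM (n + 1)" using Ipow_0 by (auto simp: Y_def)
    thus ?thesis using IM_carrier[OF m] by simp
  qed
  thus ?thesis by (rule that)
qed

text \<open>Multiplying \<open>x I\<^sup>k M \<subseteq> I\<^sup>n\<^sup>+\<^sup>k M\<close> by \<open>I\<^sup>j\<close>.\<close>
lemma module_colon_IM_shift:
  assumes x: "x \<in> module_colon R M (IM (n + k)) (IM k)" and y: "y \<in> IM (k + j)"
  shows "x \<odot>\<^bsub>M\<^esub> y \<in> IM (n + k + j)"
proof -
  have xR: "x \<in> carrier R" using x by (simp add: module_colon_def)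
  have "IM (j + k) \<subseteq> {y \<in> carrier M. \<forall>a\<in>{x}. a \<odot>\<^bsub>M\<^esub> y \<in> IM (n + k + j)}"
  proof (rule IM_add_least)
    show "submodule {y \<in> carrier M. \<forall>a\<in>{x}. a \<odot>\<^bsub>M\<^esub> y \<in> IM (n + k + j)} R M"
      by (rule colon_submodule[OF IM_submodule]) (use xR in simp)
    fix a y assume a: "a \<in> Ipow j" and y: "y \<in> IM k"
    have "x \<odot>\<^bsub>M\<^esub> y \<in> IM (n + k)" using x y by (simp add: module_colon_def)
    hence "a \<odot>\<^bsub>M\<^esub> (x \<odot>\<^bsub>M\<^esub> y) \<in> IM (j + (n + k))" by (rule smult_IM[OF a])
    thus "a \<odot>\<^bsub>M\<^esub> y \<in> {y \<in> carrier M. \<forall>a\<in>{x}. a \<odot>\<^bsub>M\<^esub> y \<in> IM (n + k + j)}"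
      using smult_commute[OF Ipow_carrier[OF a] xR IM_carrier[OF y]] a y
      by (simp add: Ipow_carrier IM_carrier add.commute add.left_commute)
  qed
  thus ?thesis using y by (auto simp: add.commute)
qed

text \<open>The union that defines \<open>r(I\<^sup>n, M)\<close> is attained at one index \<open>K\<close> for all \<open>n\<close>. If
\<open>x I\<^sup>k M \<subseteq> I\<^sup>n\<^sup>+\<^sup>k M\<close> and \<open>y \<in> I\<^sup>K M\<close>, then \<open>x y\<close> lies in \<open>I\<^sup>K M\<close>, and it climbs through the filtration
up to \<open>I\<^sup>n\<^sup>+\<^sup>K M\<close>: as long as it has not arrived, its class in the associated graded module is killed
by \<open>I\<^sup>k\<close>, hence zero.\<close>
lemma rr_ideal_eq_colon:
  obtains K where "K \<ge> 1" "\<And>n. rr_ideal R M I n = module_colon R M (IM (n + K)) (IM K)"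
proof -
  obtain K' where K': "\<And>n k m. n \<ge> K' \<Longrightarrow> m \<in> IM n \<Longrightarrow> (\<And>a. a \<in> Ipow k \<Longrightarrow> a \<odot>\<^bsub>M\<^esub> m \<in> IM (n + k + 1))
    \<Longrightarrow> m \<in> IM (n + 1)"
    using eventually_no_irrelevant_torsion by blast
  \<comment> \<open>The successor makes \<open>K\<close> positive, as the index of the union must be.\<close>
  define K where "K = Suc K'"
  have "x \<in> module_colon R M (IM (n + K)) (IM K)" if x: "x \<in> module_colon R M (IM (n + k)) (IM k)" for x n k
  proof -
    have xR: "x \<in> carrier R" using x by (simp add: module_colon_def)
    have "x \<odot>\<^bsub>M\<^esub> y \<in> IM (j + K)" if y: "y \<in> IM K" and "j \<le> n" for y j
      using \<open>j \<le> n\<close>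
    proof (induction j)
      case 0
      show ?case using submoduleE(4)[OF IM_submodule xR y] by simp
    next
      case (Suc j)
      have "x \<odot>\<^bsub>M\<^esub> y \<in> IM ((j + K) + 1)"
      proof (rule K')
        show "K' \<le> j + K" by (simp add: K_def)
        show "x \<odot>\<^bsub>M\<^esub> y \<in> IM (j + K)" using Suc by simp
        fix a assume a: "a \<in> Ipow k"
        have "x \<odot>\<^bsub>M\<^esub> (a \<odot>\<^bsub>M\<^esub> y) \<in> IM (n + k + K)"
          by (rule module_colon_IM_shift[OF x smult_IM[OF a y]])
        hence "a \<odot>\<^bsub>M\<^esub> (x \<odot>\<^bsub>M\<^esub> y) \<in> IM (n + k + K)"
          using smult_commute[OF Ipow_carrier[OF a] xR IM_carrier[OF y]] by simp
        thus "a \<odot>\<^bsub>M\<^esub> (x \<odot>\<^bsub>M\<^esub> y) \<in> IM (j + K + k + 1)"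
          using IM_antimono[of "j + K + k + 1" "n + k + K"] Suc.prems by auto
      qed
      thus ?case by simp
    qed
    thus ?thesis using xR by (simp add: module_colon_def)
  qed
  moreover have "K \<ge> 1" by (simp add: K_def)
  ultimately have "rr_ideal R M I n = module_colon R M (IM (n + K)) (IM K)" for n
    unfolding rr_ideal_def IM_def[symmetric] Ipow_def[symmetric] by auto
  thus ?thesis using that \<open>K \<ge> 1\<close> by blast
qed

section \<open>An Artin-Rees argument for the ideals \<open>r(I\<^sup>n, M)\<close>\<close>

text \<open>The multiplications \<open>x \<mapsto> (x l)\<close> for \<open>l \<in> L\<close> embed \<open>R / Ann L\<close> into a finite power of \<open>M\<close>, and the
chain condition on that power is used here without forming it. For one further element \<open>l\<close>, the
images \<open>V k n l\<close> form graded submodules of the Rees module of \<open>M\<close>, and the kernels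
\<open>V k n \<inter> Ann l\<close> are covered by the induction hypothesis.\<close>
lemma ideal_chain_stabilizes_modulo_annihilator:
  assumes "finite L" "L \<subseteq> carrier M" and bs: "set bs \<subseteq> carrier R"
    and "mono V" "\<And>k n. ideal (V (k::nat) n) R"
    and "\<And>k n b x. b \<in> set bs \<Longrightarrow> x \<in> V k n \<Longrightarrow> b \<otimes> x \<in> V k (Suc n)"
    and "\<And>k n x l. x \<in> V k n \<Longrightarrow> l \<in> L \<Longrightarrow> x \<odot>\<^bsub>M\<^esub> l \<in> power_span M bs n"
  shows "\<exists>p. \<forall>k n. \<forall>x\<in>V k n. \<exists>y\<in>V p n. \<forall>l\<in>L. x \<odot>\<^bsub>M\<^esub> l = y \<odot>\<^bsub>M\<^esub> l"
  using assms(1,2,4-)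
proof (induction L arbitrary: V rule: finite_induct)
  case empty
  thus ?case using additive_subgroup.zero_closed[OF ideal.axioms(1)] by blast
next
  case (insert l L)
  have l: "l \<in> carrier M" using insert.prems by simp
  note VR = ideal.Icarr[OF insert.prems(3)]
  obtain A where A: "finite A" "A \<subseteq> carrier M" "carrier M = gen_submodule R M A"
    by (rule finite_generators)
  have V_mono: "x \<in> V k' n" if "x \<in> V k n" "k \<le> k'" for x k k' n
    using le_funD[OF monoD[OF insert.prems(2) that(2)]] that(1) by blast
  note V_zero = additive_subgroup.zero_closed[OF ideal.axioms(1)[OF insert.prems(3)]]
    and V_add = additive_subgroup.a_closed[OF ideal.axioms(1)[OF insert.prems(3)]]
    and V_smult = ideal.I_l_closed[OF insert.prems(3)]
  define U where "U k n = (\<lambda>x. x \<odot>\<^bsub>M\<^esub> l) ` V k n" for k n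
  have "graded_family R M bs (U k)" for k
    unfolding graded_family_def
  proof (intro allI conjI ballI)
    fix n
    show "submodule (U k n) R M"
    proof (rule submodule_if_closed, goal_cases)
      case 1 show ?case using VR l by (auto simp: U_def)
    next
      case 2 
      have "\<zero>\<^bsub>M\<^esub> = \<zero> \<odot>\<^bsub>M\<^esub> l" using l by simp
      thus ?case unfolding U_def using V_zero by (rule image_eqI)
    next
      case (3 u v)
      then obtain x y where *: "x \<in> V k n" "y \<in> V k n" "u = x \<odot>\<^bsub>M\<^esub> l" "v = y \<odot>\<^bsub>M\<^esub> l"
        by (auto simp: U_def)
      hence "u \<oplus>\<^bsub>M\<^esub> v = (x \<oplus> y) \<odot>\<^bsub>M\<^esub> l" using VR l by (simp add: smult_l_distr)
      thus ?case unfolding U_def using V_add[OF *(1,2)] by (rule image_eqI)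
    next
      case (4 a u)
      then obtain x where *: "x \<in> V k n" "u = x \<odot>\<^bsub>M\<^esub> l" by (auto simp: U_def)
      hence "a \<odot>\<^bsub>M\<^esub> u = (a \<otimes> x) \<odot>\<^bsub>M\<^esub> l" using VR 4 l by (simp add: smult_assoc1)
      thus ?case unfolding U_def using V_smult[OF *(1) 4(1)] by (rule image_eqI)
    qed
    show "U k n \<subseteq> power_span M bs n" using insert.prems(5) by (auto simp: U_def)
    fix b u assume b: "b \<in> set bs" and "u \<in> U k n"
    then obtain x where *: "x \<in> V k n" "u = x \<odot>\<^bsub>M\<^esub> l" by (auto simp: U_def)
    hence "b \<odot>\<^bsub>M\<^esub> u = (b \<otimes> x) \<odot>\<^bsub>M\<^esub> l" using VR b bs l by (simp add: smult_assoc1 subset_iff)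
    thus "b \<odot>\<^bsub>M\<^esub> u \<in> U k (Suc n)" unfolding U_def using insert.prems(4)[OF b *(1)] by (rule image_eqI)
  qed
  moreover have "mono U"
    using V_mono by (auto intro!: monoI le_funI simp: U_def)
  ultimately obtain p where p: "\<And>k. k \<ge> p \<Longrightarrow> U k = U p"
    using graded_chain_stabilizes[OF noetherian A bs] by blast
  define V' where "V' k n = V k n \<inter> {x \<in> carrier R. \<forall>z\<in>{l}. x \<odot>\<^bsub>M\<^esub> z \<in> {\<zero>\<^bsub>M\<^esub>}}" for k n
  have "\<exists>q. \<forall>k n. \<forall>x\<in>V' k n. \<exists>y\<in>V' q n. \<forall>l\<in>L. x \<odot>\<^bsub>M\<^esub> l = y \<odot>\<^bsub>M\<^esub> l"
  proof (rule insert.IH)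
    show "L \<subseteq> carrier M" using insert.prems by simp
    show "mono V'" using V_mono by (auto intro!: monoI le_funI simp: V'_def)
    show "ideal (V' k n) R" for k n
      unfolding V'_def by (rule R.i_intersect[OF insert.prems(3) colon_ideal[OF zero_submodule]])
        (use l in simp)
    show "b \<otimes> x \<in> V' k (Suc n)" if "b \<in> set bs" "x \<in> V' k n" for k n b x
      using that insert.prems(4) l bs by (auto simp: V'_def smult_assoc1 subset_iff)
    show "x \<odot>\<^bsub>M\<^esub> l' \<in> power_span M bs n" if "x \<in> V' k n" "l' \<in> L" for k n x l'
      using that insert.prems(5) by (auto simp: V'_def)
  qed
  then obtain q where q: "\<And>k n x. x \<in> V' k n \<Longrightarrow> \<exists>y\<in>V' q n. \<forall>l\<in>L. x \<odot>\<^bsub>M\<^esub> l = y \<odot>\<^bsub>M\<^esub> l"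
    by blast
  have "\<exists>y\<in>V (max p q) n. \<forall>l\<in>insert l L. x \<odot>\<^bsub>M\<^esub> l = y \<odot>\<^bsub>M\<^esub> l" if x: "x \<in> V k n" for k n x
  proof -
    have "x \<odot>\<^bsub>M\<^esub> l \<in> U (max k p) n" using V_mono[OF x, of "max k p"] by (simp add: U_def)
    hence "x \<odot>\<^bsub>M\<^esub> l \<in> U p n" using p[of "max k p"] by simp
    then obtain y where y: "y \<in> V p n" "x \<odot>\<^bsub>M\<^esub> l = y \<odot>\<^bsub>M\<^esub> l" by (auto simp: U_def)
    have R: "x \<in> carrier R" "y \<in> carrier R" using VR x y by auto
    have "(\<ominus> \<one>) \<otimes> y \<in> V p n" by (rule V_smult[OF y(1)]) simp
    hence "\<ominus> y \<in> V p n" using R by (simp add: R.l_minus)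
    hence "x \<ominus> y \<in> V (max k p) n"
      unfolding a_minus_def using V_add V_mono x by simp
    moreover have "(x \<ominus> y) \<odot>\<^bsub>M\<^esub> l = \<zero>\<^bsub>M\<^esub>"
      using y(2) R l by (simp add: diff_smult) (simp add: a_minus_def M.r_neg)
    ultimately have "x \<ominus> y \<in> V' (max k p) n" using R by (simp add: V'_def)
    then obtain z where z: "z \<in> V' q n" "\<And>l. l \<in> L \<Longrightarrow> (x \<ominus> y) \<odot>\<^bsub>M\<^esub> l = z \<odot>\<^bsub>M\<^esub> l"
      using q by blast
    have zV: "z \<in> V q n" "z \<odot>\<^bsub>M\<^esub> l = \<zero>\<^bsub>M\<^esub>" "z \<in> carrier R" using z(1) by (auto simp: V'_def)
    \<comment> \<open>The element \<open>y\<close> agrees with \<open>x\<close> on \<open>l\<close>; the correction \<open>z\<close> vanishes on \<open>l\<close> and repairs \<open>y\<close> on \<open>L\<close>.\<close>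
    have "y \<oplus> z \<in> V (max p q) n" using V_add V_mono[OF y(1)] V_mono[OF zV(1)] by simp
    moreover have "x \<odot>\<^bsub>M\<^esub> l' = (y \<oplus> z) \<odot>\<^bsub>M\<^esub> l'" if "l' \<in> insert l L" for l'
    proof (cases "l' = l")
      case True
      thus ?thesis using y(2) zV R l by (simp add: smult_l_distr)
    next
      case False
      hence l': "l' \<in> L" "l' \<in> carrier M" using that insert.prems by auto
      have "(y \<oplus> z) \<odot>\<^bsub>M\<^esub> l' = y \<odot>\<^bsub>M\<^esub> l' \<oplus>\<^bsub>M\<^esub> (x \<odot>\<^bsub>M\<^esub> l' \<ominus>\<^bsub>M\<^esub> y \<odot>\<^bsub>M\<^esub> l')"
        using l' z(2)[OF l'(1)] R zV(3) by (simp add: smult_l_distr diff_smult)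
      thus ?thesis using l' R by (simp add: add_diff_cancel)
    qed
    ultimately show ?thesis by blast
  qed
  thus ?case by blast
qed

lemma Ipow_antimono: "m \<le> n \<Longrightarrow> Ipow n \<subseteq> Ipow m"
  using R.ideal_prod_inter[OF Ipow_ideal[of m] Ipow_ideal[of "n - m"]] Ipow_add[of m "n - m"] by auto

text \<open>The scalars range over an arbitrary set \<open>S\<close> because the lemma is applied to the multiples
\<open>a x\<close> of a fixed \<open>x\<close> by the elements \<open>a\<close> of a power of \<open>I\<close>.\<close>
lemma annihilates_if_annihilates_generators:
  assumes "carrier M = gen_submodule R M A" "S \<subseteq> carrier R"
    and "\<And>a y. a \<in> S \<Longrightarrow> y \<in> A \<Longrightarrow> a \<odot>\<^bsub>M\<^esub> y = \<zero>\<^bsub>M\<^esub>"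
    and "a \<in> S" "y \<in> carrier M"
  shows "a \<odot>\<^bsub>M\<^esub> y = \<zero>\<^bsub>M\<^esub>"
proof -
  have "A \<subseteq> carrier M" using gen_submodule_incl assms(1) by metis
  hence "gen_submodule R M A \<subseteq> {y \<in> carrier M. \<forall>a\<in>S. a \<odot>\<^bsub>M\<^esub> y \<in> {\<zero>\<^bsub>M\<^esub>}}"
    by (intro gen_submodule_least[OF colon_submodule[OF zero_submodule assms(2)]]) (use assms(3) in auto)
  thus ?thesis using assms(1,4,5) by auto
qed

text \<open>If \<open>x M\<close> consists of torsion elements, one power \<open>I\<^sup>e\<close> kills \<open>x y\<close> for all of the finitely many
generators \<open>y\<close>. Hence \<open>x I\<^sup>e M = 0\<close>, which is contained in \<open>I\<^sup>n\<^sup>+\<^sup>e M\<close> for every \<open>n\<close>.\<close>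
lemma torsion_colon_subset_rr_ideal:
  "module_colon R M (torsion_submodule R M I) (carrier M) \<subseteq> rr_ideal R M I n"
proof
  fix x assume x: "x \<in> module_colon R M (torsion_submodule R M I) (carrier M)"
  hence xR: "x \<in> carrier R" by (simp add: module_colon_def)
  obtain A where A: "finite A" "A \<subseteq> carrier M" "carrier M = gen_submodule R M A"
    by (rule finite_generators)
  have "\<exists>e. \<forall>a\<in>Ipow e. a \<odot>\<^bsub>M\<^esub> (x \<odot>\<^bsub>M\<^esub> y) = \<zero>\<^bsub>M\<^esub>" if "y \<in> A" for y
  proof -
    have "x \<odot>\<^bsub>M\<^esub> y \<in> torsion_submodule R M I" using x that A(2) by (auto simp: module_colon_def)
    thus ?thesis unfolding torsion_submodule_def Ipow_def[symmetric] by blast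
  qed
  then obtain f where f: "\<And>y a. y \<in> A \<Longrightarrow> a \<in> Ipow (f y) \<Longrightarrow> a \<odot>\<^bsub>M\<^esub> (x \<odot>\<^bsub>M\<^esub> y) = \<zero>\<^bsub>M\<^esub>" by metis
  \<comment> \<open>The \<open>1\<close> provides for an empty set of generators and keeps the exponent positive.\<close>
  define e where "e = Max (insert 1 (f ` A))"
  have e: "1 \<le> e" "\<And>y. y \<in> A \<Longrightarrow> f y \<le> e" using A(1) by (auto simp: e_def)
  have kill: "(a \<otimes> x) \<odot>\<^bsub>M\<^esub> y = \<zero>\<^bsub>M\<^esub>" if "a \<in> Ipow e" "y \<in> carrier M" for a y
  proof (rule annihilates_if_annihilates_generators[OF A(3)])
    show "(\<lambda>a. a \<otimes> x) ` Ipow e \<subseteq> carrier R" using Ipow_carrier xR by auto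
    show "a \<otimes> x \<in> (\<lambda>a. a \<otimes> x) ` Ipow e" using that by simp
    fix b y assume b: "b \<in> (\<lambda>a. a \<otimes> x) ` Ipow e" and y: "y \<in> A"
    then obtain c where c: "c \<in> Ipow e" "b = c \<otimes> x" by blast
    hence "c \<in> Ipow (f y)" using Ipow_antimono[OF e(2)[OF y]] by blast
    thus "b \<odot>\<^bsub>M\<^esub> y = \<zero>\<^bsub>M\<^esub>" using f[OF y] c y A(2) xR Ipow_carrier by (simp add: smult_assoc1 subset_iff)
  qed (use that in simp)
  have "IM (e + 0) \<subseteq> {y \<in> carrier M. \<forall>a\<in>{x}. a \<odot>\<^bsub>M\<^esub> y \<in> {\<zero>\<^bsub>M\<^esub>}}"
  proof (rule IM_add_least[OF colon_submodule[OF zero_submodule]])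
    fix a y assume a: "a \<in> Ipow e" and "y \<in> IM 0"
    hence y: "y \<in> carrier M" using IM_carrier by blast
    have "x \<odot>\<^bsub>M\<^esub> (a \<odot>\<^bsub>M\<^esub> y) = (a \<otimes> x) \<odot>\<^bsub>M\<^esub> y"
      using smult_commute[OF Ipow_carrier[OF a] xR y] Ipow_carrier[OF a] xR y by (simp add: smult_assoc1)
    thus "a \<odot>\<^bsub>M\<^esub> y \<in> {y \<in> carrier M. \<forall>a\<in>{x}. a \<odot>\<^bsub>M\<^esub> y \<in> {\<zero>\<^bsub>M\<^esub>}}"
      using kill[OF a y] a y Ipow_carrier by simp
  qed (use xR in simp)
  hence "x \<in> module_colon R M (IM (n + e)) (IM e)"
    using xR submodule_zero[OF IM_submodule] by (auto simp: module_colon_def)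
  thus "x \<in> rr_ideal R M I n"
    using e(1) by (auto simp: rr_ideal_def IM_def[symmetric] Ipow_def[symmetric])
qed

lemma ideal_prod_mono: "J \<subseteq> J' \<Longrightarrow> I \<cdot> J \<subseteq> I \<cdot> J'"
proof
  fix x assume "x \<in> I \<cdot> J" and J: "J \<subseteq> J'"
  from this(1) show "x \<in> I \<cdot> J'"
    by (induction rule: ideal_prod.induct) (use J in \<open>auto intro: ideal_prod.intros\<close>)
qed

lemma ideal_prod_least:
  assumes "ideal K R" "\<And>a b. a \<in> I \<Longrightarrow> b \<in> J \<Longrightarrow> a \<otimes> b \<in> K"
  shows "I \<cdot> J \<subseteq> K"
proof
  fix x assume "x \<in> I \<cdot> J"
  thus "x \<in> K"
    by (induction rule: ideal_prod.induct)
      (use assms additive_subgroup.a_closed[OF ideal.axioms(1)[OF assms(1)]] in auto)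
qed

text \<open>The Artin-Rees argument: \<open>V k\<close> is the graded submodule generated by the components of \<open>J\<close> in degrees
at most \<open>k\<close>, so it agrees with \<open>J\<close> up to degree \<open>k\<close> and is extended by powers of \<open>I\<close> beyond. When
this chain is stationary from \<open>p\<close> on, \<open>J\<close> itself is generated in degrees at most \<open>p\<close>, up to
elements that annihilate \<open>L\<close>.\<close>
lemma colon_recursion_modulo_annihilator:
  assumes ideal: "\<And>n. ideal (J n) R" and I_J: "\<And>n. I \<cdot> J n \<subseteq> J (Suc n)"
    and L: "finite L" "L \<subseteq> carrier M" and J_L: "\<And>n x l. x \<in> J n \<Longrightarrow> l \<in> L \<Longrightarrow> x \<odot>\<^bsub>M\<^esub> l \<in> IM n"
  obtains p where "\<And>n x. n \<ge> p \<Longrightarrow> x \<in> J (Suc n) \<Longrightarrow> \<exists>y\<in>I \<cdot> J n. \<forall>l\<in>L. x \<odot>\<^bsub>M\<^esub> l = y \<odot>\<^bsub>M\<^esub> l"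
proof -
  obtain bs where bs: "set bs \<subseteq> I" "\<And>K. ideal K R \<Longrightarrow> set bs \<subseteq> K \<Longrightarrow> I \<subseteq> K"
    using ideal_generators[OF I_ideal] by blast
  define V where "V k n = (((\<cdot>) I) ^^ (n - k)) (J (min n k))" for k n
  have V_le: "V k n = J n" if "n \<le> k" for k n
    using that by (simp add: V_def)
  have V_Suc: "V k (Suc n) = I \<cdot> V k n" if "k \<le> n" for k n
    using that by (simp add: V_def Suc_diff_le)
  have V_ideal: "ideal (V k n) R" for k n
  proof -
    have "ideal ((((\<cdot>) I) ^^ d) (J m)) R" for d m
      by (induction d) (use ideal R.ideal_prod_is_ideal[OF I_ideal] in auto)
    thus ?thesis by (simp add: V_def)
  qed
  have V_sub: "V k n \<subseteq> J n" for k n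
  proof (induction n)
    case (Suc n)
    show ?case
    proof (cases "Suc n \<le> k")
      case False
      hence "V k (Suc n) = I \<cdot> V k n" by (intro V_Suc) simp
      thus ?thesis using ideal_prod_mono[OF Suc] I_J by blast
    qed (simp add: V_le)
  qed (simp add: V_le)
  have V_prod: "I \<cdot> V k n \<subseteq> V k (Suc n)" for k n
  proof (cases "Suc n \<le> k")
    case True
    thus ?thesis using I_J by (simp add: V_le)
  next
    case False
    thus ?thesis using V_Suc[of k n] by simp
  qed
  have "mono V"
    unfolding mono_iff_le_Suc
  proof (intro allI le_funI)
    fix k n
    show "V k n \<subseteq> V (Suc k) n"
    proof (induction n)
      case (Suc n)
      show ?case
      proof (cases "Suc n \<le> Suc k")
        case True
        thus ?thesis using V_sub[of k "Suc n"] by (simp add: V_le)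
      next
        case False
        thus ?thesis using ideal_prod_mono[OF Suc] V_Suc[of k n] V_Suc[of "Suc k" n] by simp
      qed
    qed (simp add: V_le)
  qed
  have "\<exists>p. \<forall>k n. \<forall>x\<in>V k n. \<exists>y\<in>V p n. \<forall>l\<in>L. x \<odot>\<^bsub>M\<^esub> l = y \<odot>\<^bsub>M\<^esub> l"
  proof (rule ideal_chain_stabilizes_modulo_annihilator[OF L _ \<open>mono V\<close> V_ideal])
    show "set bs \<subseteq> carrier R" using bs(1) ideal.Icarr[OF I_ideal] by blast
    show "b \<otimes> x \<in> V k (Suc n)" if "b \<in> set bs" "x \<in> V k n" for k n b x
      by (rule subsetD[OF V_prod ideal_prod.prod[OF subsetD[OF bs(1) that(1)] that(2)]])
    show "x \<odot>\<^bsub>M\<^esub> l \<in> power_span M bs n" if "x \<in> V k n" "l \<in> L" for k n x l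
      using J_L[of x n l] that V_sub IM_subset_power_span[OF bs] by blast
  qed
  then obtain p where p: "\<And>k n x. x \<in> V k n \<Longrightarrow> \<exists>y\<in>V p n. \<forall>l\<in>L. x \<odot>\<^bsub>M\<^esub> l = y \<odot>\<^bsub>M\<^esub> l" by blast
  have "\<exists>y\<in>I \<cdot> J n. \<forall>l\<in>L. x \<odot>\<^bsub>M\<^esub> l = y \<odot>\<^bsub>M\<^esub> l" if "n \<ge> p" "x \<in> J (Suc n)" for n x
    using p[of x "Suc n" "Suc n"] that V_le[of "Suc n" "Suc n"] V_Suc[OF that(1)]
      ideal_prod_mono[OF V_sub[of p n]] by auto
  thus ?thesis by (rule that)
qed

text \<open>The set \<open>L\<close> consists of generators of \<open>I\<^sup>K M\<close>. The annihilator of \<open>I\<^sup>K M\<close> is contained in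
\<open>(H\<^sup>0\<^sub>I(M) : M)\<close>, because \<open>I\<^sup>K\<close> kills \<open>x M\<close> whenever \<open>x I\<^sup>K M = 0\<close>; so the equality modulo
annihilators of the preceding lemma is good enough.\<close>
theorem rr_ideal_recursion:
  "\<exists>N\<ge>1. \<forall>n\<ge>N. rr_ideal R M I (n + 1) =
    (I \<cdot> rr_ideal R M I n) <+>\<^bsub>R\<^esub> module_colon R M (torsion_submodule R M I) (carrier M)"
proof -
  let ?T = "module_colon R M (torsion_submodule R M I) (carrier M)"
  obtain K where K: "K \<ge> 1" "\<And>n. rr_ideal R M I n = module_colon R M (IM (n + K)) (IM K)"
    using rr_ideal_eq_colon by blast
  define J where "J n = module_colon R M (IM (n + K)) (IM K)" for n
  have rr: "rr_ideal R M I n = J n" for n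
    using K(2) by (simp add: J_def)
  have J_carrier: "x \<in> carrier R" if "x \<in> J n" for x n
    using that by (simp add: J_def module_colon_def)
  have ideal: "ideal (J n) R" for n
    unfolding J_def module_colon_def by (rule colon_ideal[OF IM_submodule]) (use IM_carrier in blast)
  have I_J: "I \<cdot> J n \<subseteq> J (Suc n)" for n
  proof (rule ideal_prod_least[OF ideal])
    fix a b assume a: "a \<in> I" and b: "b \<in> J n"
    hence R: "a \<in> carrier R" "b \<in> carrier R" using ideal.Icarr[OF I_ideal] J_carrier by auto
    have "(a \<otimes> b) \<odot>\<^bsub>M\<^esub> y \<in> IM (Suc n + K)" if y: "y \<in> IM K" for y
    proof -
      have "b \<odot>\<^bsub>M\<^esub> y \<in> IM (n + K)" using b y by (simp add: J_def module_colon_def)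
      moreover have "a \<in> Ipow 1" using a unfolding Ipow_1 .
      ultimately have "a \<odot>\<^bsub>M\<^esub> (b \<odot>\<^bsub>M\<^esub> y) \<in> IM (1 + (n + K))" by (rule smult_IM[rotated])
      thus ?thesis using R IM_carrier[OF y] by (simp add: smult_assoc1)
    qed
    thus "a \<otimes> b \<in> J (Suc n)" using R by (simp add: J_def module_colon_def)
  qed
  obtain A where A: "finite A" "A \<subseteq> carrier M" "carrier M = gen_submodule R M A"
    by (rule finite_generators)
  obtain cs where cs: "set cs \<subseteq> Ipow K" "\<And>C. ideal C R \<Longrightarrow> set cs \<subseteq> C \<Longrightarrow> Ipow K \<subseteq> C"
    using ideal_generators[OF Ipow_ideal] by blast
  define L where "L = (\<lambda>(c, y). c \<odot>\<^bsub>M\<^esub> y) ` (set cs \<times> A)"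
  have L_IM: "L \<subseteq> IM K" unfolding L_def using smult_in_IM[OF subsetD[OF cs(1)] subsetD[OF A(2)]] by auto
  have annihilator_L: "x \<in> ?T" if x: "x \<in> carrier R" "\<And>l. l \<in> L \<Longrightarrow> x \<odot>\<^bsub>M\<^esub> l = \<zero>\<^bsub>M\<^esub>" for x
  proof -
    have gen: "c \<odot>\<^bsub>M\<^esub> (x \<odot>\<^bsub>M\<^esub> y) = \<zero>\<^bsub>M\<^esub>" if c: "c \<in> Ipow K" and y: "y \<in> A" for c y
    proof -
      have yM: "y \<in> carrier M" using y A(2) by blast
      let ?C = "{c \<in> carrier R. \<forall>z\<in>{x \<odot>\<^bsub>M\<^esub> y}. c \<odot>\<^bsub>M\<^esub> z \<in> {\<zero>\<^bsub>M\<^esub>}}"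
      have "Ipow K \<subseteq> ?C"
      proof (rule cs(2)[OF colon_ideal[OF zero_submodule]])
        show "{x \<odot>\<^bsub>M\<^esub> y} \<subseteq> carrier M" using x yM by simp
        have "c \<odot>\<^bsub>M\<^esub> (x \<odot>\<^bsub>M\<^esub> y) = \<zero>\<^bsub>M\<^esub>" if c: "c \<in> set cs" for c
        proof -
          have "c \<odot>\<^bsub>M\<^esub> y \<in> L" using c y by (auto simp: L_def)
          thus ?thesis using x smult_commute[OF _ x(1) yM] c cs(1) Ipow_carrier by (metis subsetD)
        qed
        thus "set cs \<subseteq> ?C" using cs(1) Ipow_carrier by auto
      qed
      thus ?thesis using c by auto
    qed
    have all: "c \<odot>\<^bsub>M\<^esub> (x \<odot>\<^bsub>M\<^esub> y) = \<zero>\<^bsub>M\<^esub>" if c: "c \<in> Ipow K" and y: "y \<in> carrier M" for c y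
    proof -
      have "(c \<otimes> x) \<odot>\<^bsub>M\<^esub> y = \<zero>\<^bsub>M\<^esub>"
      proof (rule annihilates_if_annihilates_generators[OF A(3) _ _ _ y])
        show "(\<lambda>c. c \<otimes> x) ` Ipow K \<subseteq> carrier R" using Ipow_carrier x(1) by auto
        show "a \<odot>\<^bsub>M\<^esub> y = \<zero>\<^bsub>M\<^esub>" if "a \<in> (\<lambda>c. c \<otimes> x) ` Ipow K" "y \<in> A" for a y
          using that gen x(1) A(2) Ipow_carrier by (auto simp: smult_assoc1 subset_iff)
        show "c \<otimes> x \<in> (\<lambda>c. c \<otimes> x) ` Ipow K" using c by simp
      qed
      thus ?thesis using c x(1) y Ipow_carrier by (simp add: smult_assoc1)
    qed
    show ?thesis
      using x(1) all K(1)
      by (auto simp: module_colon_def torsion_submodule_def Ipow_def[symmetric] intro!: exI[of _ K])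
  qed
  have "finite L" using A(1) by (simp add: L_def)
  moreover have "x \<odot>\<^bsub>M\<^esub> l \<in> IM n" if "x \<in> J n" "l \<in> L" for n x l
    using that L_IM IM_antimono[of n "n + K"] by (auto simp: J_def module_colon_def)
  ultimately obtain p where p: "\<And>n x. n \<ge> p \<Longrightarrow> x \<in> J (Suc n) \<Longrightarrow>
      \<exists>y\<in>I \<cdot> J n. \<forall>l\<in>L. x \<odot>\<^bsub>M\<^esub> l = y \<odot>\<^bsub>M\<^esub> l"
    using colon_recursion_modulo_annihilator[of J L, OF ideal I_J] L_IM IM_carrier by blast
  have "J (Suc n) = (I \<cdot> J n) <+>\<^bsub>R\<^esub> ?T" if n: "n \<ge> p" for n
  proof
    show "J (Suc n) \<subseteq> (I \<cdot> J n) <+>\<^bsub>R\<^esub> ?T"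
    proof
      fix x assume x: "x \<in> J (Suc n)"
      then obtain y where y: "y \<in> I \<cdot> J n" "\<And>l. l \<in> L \<Longrightarrow> x \<odot>\<^bsub>M\<^esub> l = y \<odot>\<^bsub>M\<^esub> l"
        using p[OF n] by blast
      have R: "x \<in> carrier R" "y \<in> carrier R" using x y(1) I_J J_carrier by blast+
      have "x \<ominus> y \<in> ?T"
      proof (rule annihilator_L)
        fix l assume l: "l \<in> L"
        hence "l \<in> carrier M" using L_IM IM_carrier by blast
        thus "(x \<ominus> y) \<odot>\<^bsub>M\<^esub> l = \<zero>\<^bsub>M\<^esub>"
          using y(2)[OF l] R by (simp add: diff_smult) (simp add: a_minus_def M.r_neg)
      qed (use R in simp)
      moreover have "x = y \<oplus> (x \<ominus> y)" using R by (simp add: a_minus_def R.a_ac R.r_neg)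
      ultimately show "x \<in> (I \<cdot> J n) <+>\<^bsub>R\<^esub> ?T" using y(1) by (auto simp: set_add_def')
    qed
    have "?T \<subseteq> J (Suc n)" using torsion_colon_subset_rr_ideal rr by blast
    thus "(I \<cdot> J n) <+>\<^bsub>R\<^esub> ?T \<subseteq> J (Suc n)"
      using I_J[of n] additive_subgroup.a_closed[OF ideal.axioms(1)[OF ideal[of "Suc n"]]]
      unfolding set_add_def' by blast
  qed
  hence "\<forall>n\<ge>max 1 p. rr_ideal R M I (n + 1) = (I \<cdot> rr_ideal R M I n) <+>\<^bsub>R\<^esub> ?T"
    by (simp add: rr)
  thus ?thesis using max.cobounded1 by blast
qed

end

theorem theorem7p3:
  fixes R :: "('a, 'r) ring_scheme" and M :: "('a, 'b, 'm) module_scheme" and I :: "'a set"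
  assumes "cring R" and "noetherian_ring R"
    and "ideal I R"
    and "module R M" and "fin_gen_module R M"
    and "carrier M \<noteq> torsion_submodule R M I"
  shows "\<exists>N\<ge>1. \<forall>n\<ge>N. rr_ideal R M I (n + 1) =
    (I \<cdot>\<^bsub>R\<^esub> rr_ideal R M I n) <+>\<^bsub>R\<^esub> module_colon R M (torsion_submodule R M I) (carrier M)"
proof -
  interpret fg_module_with_ideal R M I
    by (intro fg_module_with_ideal.intro fg_module_with_ideal_axioms.intro assms)
  show ?thesis by (rule rr_ideal_recursion)
qed

end
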